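(* Under Assumptions A1, A2, A3, A4 and A5 (defined in the context), strong duality holds between the sum-of-rational measure linear program (R) and the function linear program (F): $p^*_r=d^*_r$.
   Context: Setting. Let $n,L\in\mathbb{N}$, $T>0$, $X\subseteq\mathbb{R}^n$ a state space and $X_0\subseteq X$ a (nonempty) initial set. The dynamics are rational: $\dot x(t)=f(t,x(t))$ with $$f(t,x)=f_0(t,x)+\sum_{\ell=1}^{L}\frac{N_\ell(t,x)}{D_\ell(t,x)},$$ where $f_0,N_\ell$ are $\mathbb{R}^n$-valued polynomials in $(t,x)$ and $D_\ell$ are real-valued polynomials in $(t,x)$. A trajectory starting at $x_0$ is an absolutely continuous curve $t\mapsto x(t\mid x_0)$ with $x(0\mid x_0)=x_0$ that satisfies the ODE for almost every $t$. Let $p:X\to\mathbb{R}$ be a state function. Notation. $\mathcal{M}_+(S)$ is the set of nonnegative Borel measures on $S$; $\langle g,\mu\rangle=\int g\,d\mu$; $C(S)$ is the set of continuous functions on $S$. $C^1([0,T]\times X)$ denotes functions that are $C^1$ (on a neighborhood of $[0,T]\times X$). For $v\in C^1([0,T]\times X)$, $\mathcal{L}_{f_0}v(t,x)=\partial_t v(t,x)+f_0(t,x)\cdot\nabla_x v(t,x)$. Sum-of-rational measure program (R): $$p^*_r=\sup\ \langle p,\mu_p\rangle$$ over $\mu_0\in\mathcal{M}_+(X_0)$ and $\mu,\mu_p,\nu_1,\dots,\nu_L\in\mathcal{M}_+([0,T]\times X)$ subject to: (i) $\mu_p=\delta_0\otimes\mu_0+\mathcal{L}_{f_0}^\dagger\mu+\sum_{\ell=1}^{L}(N_\ell\cdot\nabla_x)^\dagger\nu_\ell$,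 meaning that for all $v\in C^1([0,T]\times X)$, $$\langle v(t,x),\mu_p\rangle=\langle v(0,x),\mu_0\rangle+\langle\mathcal{L}_{f_0}v,\mu\rangle+\sum_{\ell=1}^{L}\langle N_\ell\cdot\nabla_x v,\nu_\ell\rangle;$$ (ii) for all $\ell$, $D_\ell^\dagger\nu_\ell=\mu$, meaning $\langle \omega D_\ell,\nu_\ell\rangle=\langle\omega,\mu\rangle$ for all $\omega\in C([0,T]\times X)$; (iii) $\langle 1,\mu_0\rangle=1$. Function program (F): $$d^*_r=\inf\ \gamma$$ over $\gamma\in\mathbb{R}$, $v\in C^1([0,T]\times X)$ and $q_1,\dots,q_L\in C([0,T]\times X)$ subject to: $\gamma\ge v(0,x)$ for all $x\in X_0$; $v(t,x)\ge p(x)$ for all $(t,x)\in[0,T]\times X$; $-\mathcal{L}_{f_0}v(t,x)-\sum_{\ell=1}^{L}q_\ell(t,x)\ge 0$ for all $(t,x)\in[0,T]\times X$; $D_\ell(t,x)q_\ell(t,x)-N_\ell(t,x)\cdot\nabla_x v(t,x)\ge 0$ for all $(t,x)\in[0,T]\times X$ and all $\ell\in\{1,\dots,L\}$. Assumptions. A1 (non-return): if a trajectory satisfies $x(t\mid x_0)\notin X$ for some $x_0\in X_0$, then $x(t'\mid x_0)\notin X$ for all $t'\ge t$. A2: the set $[0,T]\times X_0\times X$ is compact. A3: the cost $p(x)$ is continuous. A4: trajectories of the ODE starting at $X_0$ in times $[0,T]$ are unique (any two trajectories with the same initial condition $x_0\in X_0$ agree where both are defined in $[0,T]$). A5: each function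 $D_\ell$ is strictly positive over $[0,T]\times X$. *)

theory Defs
  imports "HOL-Analysis.Analysis"
begin

text \<open>
  Space-time points are pairs \<open>(t, x)\<close> of type \<open>real \<times> (real^'n)\<close>; functions of time and state
  (the polynomials \<open>f0\<close>, \<open>N l\<close>, \<open>D l\<close>, test functions \<open>v\<close>, and so on) are uncurried.
  The rational terms are indexed by \<open>l \<in> {1..L}\<close>; values at other indices are irrelevant.
\<close>

definition nonneg_measures_on :: "'a::topological_space set \<Rightarrow> 'a measure set" where
  "nonneg_measures_on S = {M. sets M = sets (restrict_space borel S) \<and> finite_measure M}"

definition C1_nbhd :: "'a::real_normed_vector set \<Rightarrow> ('a \<Rightarrow> real) \<Rightarrow> bool" where
  "C1_nbhd S v \<longleftrightarrow> (\<exists>U v'. open U \<and> S \<subseteq> U \<and>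
     (\<forall>z\<in>U. (v has_derivative blinfun_apply (v' z)) (at z)) \<and> continuous_on U v')"

definition time_deriv :: "(real \<times> (real^'n) \<Rightarrow> real) \<Rightarrow> real \<times> (real^'n) \<Rightarrow> real" where
  "time_deriv v = (\<lambda>(t, x). deriv (\<lambda>s. v (s, x)) t)"

definition grad_x :: "(real \<times> (real^'n) \<Rightarrow> real) \<Rightarrow> real \<times> (real^'n) \<Rightarrow> real^'n" where
  "grad_x v = (\<lambda>(t, x). \<chi> i. frechet_derivative (\<lambda>y. v (t, y)) (at x) (axis i 1))"

definition Lie_deriv ::
  "(real \<times> (real^'n) \<Rightarrow> real^'n) \<Rightarrow> (real \<times> (real^'n) \<Rightarrow> real) \<Rightarrow> real \<times> (real^'n) \<Rightarrow> real" where
  "Lie_deriv f v z = time_deriv v z + f z \<bullet> grad_x v z"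

subsection \<open>Trajectories of the rational dynamics\<close>

definition rational_field ::
  "nat \<Rightarrow> (real \<times> (real^'n) \<Rightarrow> real^'n) \<Rightarrow> (nat \<Rightarrow> real \<times> (real^'n) \<Rightarrow> real^'n) \<Rightarrow>
   (nat \<Rightarrow> real \<times> (real^'n) \<Rightarrow> real) \<Rightarrow> real \<times> (real^'n) \<Rightarrow> real^'n" where
  "rational_field L f0 N D z = f0 z + (\<Sum>l\<in>{1..L}. (1 / D l z) *\<^sub>R N l z)"

text \<open>
  Absolute continuity of a curve: \<open>d\<close> ranges over finite families of non-overlapping compact
  intervals \<open>{Inf k..Sup k}\<close> contained in \<open>S\<close>.
\<close>

definition abs_continuous_curve :: "real set \<Rightarrow> (real \<Rightarrow> 'a::real_normed_vector) \<Rightarrow> bool" where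
  "abs_continuous_curve S x \<longleftrightarrow>
     (\<forall>e>0. \<exists>\<delta>>0. \<forall>d. d division_of \<Union>d \<and> \<Union>d \<subseteq> S \<and> (\<Sum>k\<in>d. Sup k - Inf k) < \<delta> \<longrightarrow>
        (\<Sum>k\<in>d. norm (x (Sup k) - x (Inf k))) < e)"

text \<open>
  A trajectory on \<open>{0..\<tau>}\<close> starting at \<open>x0\<close>. The right-hand side is undefined where some
  denominator vanishes; as division by zero is total in HOL, this is excluded explicitly.
  The values of \<open>x\<close> outside \<open>{0..\<tau>}\<close> are irrelevant, and \<open>x\<close> need not stay in the state space.
\<close>

definition trajectory ::
  "nat \<Rightarrow> (real \<times> (real^'n) \<Rightarrow> real^'n) \<Rightarrow> (nat \<Rightarrow> real \<times> (real^'n) \<Rightarrow> real^'n) \<Rightarrow>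
   (nat \<Rightarrow> real \<times> (real^'n) \<Rightarrow> real) \<Rightarrow> real \<Rightarrow> real^'n \<Rightarrow> (real \<Rightarrow> real^'n) \<Rightarrow> bool" where
  "trajectory L f0 N D \<tau> x0 x \<longleftrightarrow>
     0 \<le> \<tau> \<and> x 0 = x0 \<and> abs_continuous_curve {0..\<tau>} x \<and>
     (AE t in lborel. t \<in> {0..\<tau>} \<longrightarrow>
        (\<forall>l\<in>{1..L}. D l (t, x t) \<noteq> 0) \<and>
        (x has_vector_derivative rational_field L f0 N D (t, x t)) (at t within {0..\<tau>}))"

definition non_return ::
  "nat \<Rightarrow> (real \<times> (real^'n) \<Rightarrow> real^'n) \<Rightarrow> (nat \<Rightarrow> real \<times> (real^'n) \<Rightarrow> real^'n) \<Rightarrow>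
   (nat \<Rightarrow> real \<times> (real^'n) \<Rightarrow> real) \<Rightarrow> (real^'n) set \<Rightarrow> (real^'n) set \<Rightarrow> bool" where
  "non_return L f0 N D X0 X \<longleftrightarrow>
     (\<forall>x0\<in>X0. \<forall>\<tau> x. trajectory L f0 N D \<tau> x0 x \<longrightarrow>
        (\<forall>t\<in>{0..\<tau>}. x t \<notin> X \<longrightarrow> (\<forall>t'\<in>{t..\<tau>}. x t' \<notin> X)))"

definition unique_trajectories ::
  "nat \<Rightarrow> (real \<times> (real^'n) \<Rightarrow> real^'n) \<Rightarrow> (nat \<Rightarrow> real \<times> (real^'n) \<Rightarrow> real^'n) \<Rightarrow>
   (nat \<Rightarrow> real \<times> (real^'n) \<Rightarrow> real) \<Rightarrow> real \<Rightarrow> (real^'n) set \<Rightarrow> bool" where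
  "unique_trajectories L f0 N D T X0 \<longleftrightarrow>
     (\<forall>x0\<in>X0. \<forall>\<tau>1 x1 \<tau>2 x2.
        trajectory L f0 N D \<tau>1 x0 x1 \<and> trajectory L f0 N D \<tau>2 x0 x2 \<longrightarrow>
        (\<forall>t\<in>{0..\<tau>1} \<inter> {0..\<tau>2} \<inter> {0..T}. x1 t = x2 t))"

subsection \<open>The measure program and the function program\<close>

definition measure_feasible ::
  "nat \<Rightarrow> (real \<times> (real^'n) \<Rightarrow> real^'n) \<Rightarrow> (nat \<Rightarrow> real \<times> (real^'n) \<Rightarrow> real^'n) \<Rightarrow>
   (nat \<Rightarrow> real \<times> (real^'n) \<Rightarrow> real) \<Rightarrow> real \<Rightarrow> (real^'n) set \<Rightarrow> (real^'n) set \<Rightarrow>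
   (real^'n) measure \<Rightarrow> (real \<times> (real^'n)) measure \<Rightarrow> (real \<times> (real^'n)) measure \<Rightarrow>
   (nat \<Rightarrow> (real \<times> (real^'n)) measure) \<Rightarrow> bool" where
  "measure_feasible L f0 N D T X0 X \<mu>0 \<mu> \<mu>p \<nu> \<longleftrightarrow>
     \<mu>0 \<in> nonneg_measures_on X0 \<and>
     \<mu> \<in> nonneg_measures_on ({0..T} \<times> X) \<and>
     \<mu>p \<in> nonneg_measures_on ({0..T} \<times> X) \<and>
     (\<forall>l\<in>{1..L}. \<nu> l \<in> nonneg_measures_on ({0..T} \<times> X)) \<and>
     (\<forall>v. C1_nbhd ({0..T} \<times> X) v \<longrightarrow>
        (\<integral>z. v z \<partial>\<mu>p) = (\<integral>x. v (0, x) \<partial>\<mu>0) + (\<integral>z. Lie_deriv f0 v z \<partial>\<mu>)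
           + (\<Sum>l\<in>{1..L}. \<integral>z. N l z \<bullet> grad_x v z \<partial>(\<nu> l))) \<and>
     (\<forall>l\<in>{1..L}. \<forall>\<omega>. continuous_on ({0..T} \<times> X) \<omega> \<longrightarrow>
        (\<integral>z. \<omega> z * D l z \<partial>(\<nu> l)) = (\<integral>z. \<omega> z \<partial>\<mu>)) \<and>
     (\<integral>x. 1 \<partial>\<mu>0) = (1::real)"

definition measure_value ::
  "nat \<Rightarrow> (real \<times> (real^'n) \<Rightarrow> real^'n) \<Rightarrow> (nat \<Rightarrow> real \<times> (real^'n) \<Rightarrow> real^'n) \<Rightarrow>
   (nat \<Rightarrow> real \<times> (real^'n) \<Rightarrow> real) \<Rightarrow> real \<Rightarrow> (real^'n) set \<Rightarrow> (real^'n) set \<Rightarrow>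
   (real^'n \<Rightarrow> real) \<Rightarrow> ereal" where
  "measure_value L f0 N D T X0 X p =
     Sup {ereal (\<integral>(t, x). p x \<partial>\<mu>p) | \<mu>0 \<mu> \<mu>p \<nu>. measure_feasible L f0 N D T X0 X \<mu>0 \<mu> \<mu>p \<nu>}"

definition function_feasible ::
  "nat \<Rightarrow> (real \<times> (real^'n) \<Rightarrow> real^'n) \<Rightarrow> (nat \<Rightarrow> real \<times> (real^'n) \<Rightarrow> real^'n) \<Rightarrow>
   (nat \<Rightarrow> real \<times> (real^'n) \<Rightarrow> real) \<Rightarrow> real \<Rightarrow> (real^'n) set \<Rightarrow> (real^'n) set \<Rightarrow>
   (real^'n \<Rightarrow> real) \<Rightarrow>
   real \<Rightarrow> (real \<times> (real^'n) \<Rightarrow> real) \<Rightarrow> (nat \<Rightarrow> real \<times> (real^'n) \<Rightarrow> real) \<Rightarrow> bool" where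
  "function_feasible L f0 N D T X0 X p \<gamma> v q \<longleftrightarrow>
     C1_nbhd ({0..T} \<times> X) v \<and>
     (\<forall>l\<in>{1..L}. continuous_on ({0..T} \<times> X) (q l)) \<and>
     (\<forall>x\<in>X0. \<gamma> \<ge> v (0, x)) \<and>
     (\<forall>t\<in>{0..T}. \<forall>x\<in>X. v (t, x) \<ge> p x) \<and>
     (\<forall>z\<in>{0..T} \<times> X. - Lie_deriv f0 v z - (\<Sum>l\<in>{1..L}. q l z) \<ge> 0) \<and>
     (\<forall>l\<in>{1..L}. \<forall>z\<in>{0..T} \<times> X. D l z * q l z - N l z \<bullet> grad_x v z \<ge> 0)"

definition function_value ::
  "nat \<Rightarrow> (real \<times> (real^'n) \<Rightarrow> real^'n) \<Rightarrow> (nat \<Rightarrow> real \<times> (real^'n) \<Rightarrow> real^'n) \<Rightarrow>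
   (nat \<Rightarrow> real \<times> (real^'n) \<Rightarrow> real) \<Rightarrow> real \<Rightarrow> (real^'n) set \<Rightarrow> (real^'n) set \<Rightarrow>
   (real^'n \<Rightarrow> real) \<Rightarrow> ereal" where
  "function_value L f0 N D T X0 X p =
     Inf {ereal \<gamma> | \<gamma> v q. function_feasible L f0 N D T X0 X p \<gamma> v q}"

end

theory Submission
  imports Defs
begin

text \<open>
  Because every \<open>D l\<close> is positive, both programs reduce to the rational field \<open>f\<close> itself: the
  constraint \<open>D l * \<nu> l = \<mu>\<close> forces \<open>\<nu> l\<close> to be \<open>\<mu>\<close> with density \<open>1 / D l\<close>, and the best choice of
  \<open>q l\<close> is \<open>(N l \<bullet> grad_x v) / D l\<close>. What remains is the duality between the Liouville equation
  \<open>\<mu>p = \<delta> \<otimes> \<mu>0 + L\<^sub>f\<^sup>* \<mu>\<close> and the inequalities \<open>\<gamma> \<ge> v (0, x)\<close>, \<open>v \<ge> p\<close>, \<open>L\<^sub>f v \<le> 0\<close> on compact sets.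

  One inequality is integration of the constraints (\<open>weak_duality\<close>). For the other, let \<open>d\<close> be the
  infimum of the function program and perturb the three inequalities by bounded functions
  \<open>a\<close> on \<open>X0\<close> and \<open>b\<close>, \<open>c\<close> on \<open>{0..T} \<times> X\<close>. The least \<open>\<gamma>\<close> that the perturbed inequalities admit, in
  homogenised form, is a sublinear function of \<open>(a, b, c)\<close>. It is finite since a perturbation of size
  \<open>B\<close> is compensated by adding \<open>B + B * (T - t)\<close> to \<open>v\<close>: this is where the finite horizon enters, and
  it takes the place of a bound on the masses of feasible measures. The Hahn-Banach theorem
  (\<open>sublinear_dominates_linear\<close>) gives a linear functional below this sublinear one. Its three
  components are positive, they satisfy the Liouville equation because the perturbation that a test
  function \<open>v\<close> compensates has value at most \<open>0\<close>, and so has the one of \<open>- v\<close>; and the component on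
  which \<open>v \<ge> p\<close> is perturbed takes a value of at least \<open>d\<close> at \<open>p\<close>. The Riesz representation
  theorem (\<open>riesz_representation\<close>) turns them into measures, so the supremum of the measure program
  is attained (\<open>liouville_measures_attain\<close>).

  Two classical theorems are proved on the way. Hahn-Banach uses that a minimal sublinear functional
  is linear. Riesz exploits that the functional at hand is defined on all bounded
  functions, not only on continuous ones: a compact set in a Euclidean space lies on a space-filling
  curve, and along a parametrisation of it the functional has a cumulative distribution function,
  whose Stieltjes measure is pushed forward by the curve.
\<close>

section \<open>Sublinear and linear functionals\<close>

definition sublinear_on :: "('i \<Rightarrow> real) set \<Rightarrow> (('i \<Rightarrow> real) \<Rightarrow> real) \<Rightarrow> bool" where
  "sublinear_on V Q \<longleftrightarrow>
     (\<forall>f\<in>V. \<forall>g\<in>V. Q (\<lambda>i. f i + g i) \<le> Q f + Q g) \<and>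
     (\<forall>f\<in>V. \<forall>c>0. Q (\<lambda>i. c * f i) \<le> c * Q f)"

definition linear_functional_on :: "('i \<Rightarrow> real) set \<Rightarrow> (('i \<Rightarrow> real) \<Rightarrow> real) \<Rightarrow> bool" where
  "linear_functional_on V \<Lambda> \<longleftrightarrow>
     (\<forall>f\<in>V. \<forall>g\<in>V. \<Lambda> (\<lambda>i. f i + g i) = \<Lambda> f + \<Lambda> g) \<and>
     (\<forall>f\<in>V. \<forall>c. \<Lambda> (\<lambda>i. c * f i) = c * \<Lambda> f)"

text \<open>
  Spaces of real functions are closed sets of functions under the pointwise operations, as the
  function type carries no vector space structure of its own.
\<close>

definition function_space :: "('i \<Rightarrow> real) set \<Rightarrow> bool" where
  "function_space V \<longleftrightarrow> (\<lambda>_. 0) \<in> V \<and> (\<forall>f\<in>V. \<forall>g\<in>V. (\<lambda>i. f i + g i) \<in> V) \<and>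
     (\<forall>f\<in>V. \<forall>c. (\<lambda>i. c * f i) \<in> V)"

lemma sublinear_onD:
  assumes "sublinear_on V Q" "f \<in> V"
  shows "g \<in> V \<Longrightarrow> Q (\<lambda>i. f i + g i) \<le> Q f + Q g" and "c > 0 \<Longrightarrow> Q (\<lambda>i. c * f i) \<le> c * Q f"
  using assms unfolding sublinear_on_def by auto

lemma linear_functional_onD:
  assumes "linear_functional_on V \<Lambda>" "f \<in> V"
  shows "g \<in> V \<Longrightarrow> \<Lambda> (\<lambda>i. f i + g i) = \<Lambda> f + \<Lambda> g" and "\<Lambda> (\<lambda>i. c * f i) = c * \<Lambda> f"
  using assms unfolding linear_functional_on_def by auto

lemma function_spaceD:
  assumes "function_space V"
  shows "(\<lambda>_. 0) \<in> V" and "f \<in> V \<Longrightarrow> g \<in> V \<Longrightarrow> (\<lambda>i. f i + g i) \<in> V"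
    and "f \<in> V \<Longrightarrow> (\<lambda>i. c * f i) \<in> V" and "f \<in> V \<Longrightarrow> (\<lambda>i. - f i) \<in> V"
proof -
  show "f \<in> V \<Longrightarrow> (\<lambda>i. - f i) \<in> V"
    using assms by (auto simp: function_space_def dest!: bspec spec[of _ "-1"])
qed (use assms in \<open>auto simp: function_space_def\<close>)

lemma sublinear_zero:
  assumes V: "function_space V" and Q: "sublinear_on V Q"
  shows "Q (\<lambda>_. 0) = 0"
  using sublinear_onD(2)[OF Q function_spaceD(1)[OF V], of 2]
    sublinear_onD(2)[OF Q function_spaceD(1)[OF V], of "1/2"] by simp

lemma sublinear_homogeneous:
  assumes V: "function_space V" and Q: "sublinear_on V Q" and f: "f \<in> V" and c: "c \<ge> 0"
  shows "Q (\<lambda>i. c * f i) = c * Q f"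
proof (cases "c = 0")
  case True
  then show ?thesis using sublinear_zero[OF V Q] by simp
next
  case False
  then have c: "c > 0" using c by simp
  have "Q (\<lambda>i. (1 / c) * (c * f i)) \<le> (1 / c) * Q (\<lambda>i. c * f i)"
    using sublinear_onD(2)[OF Q function_spaceD(3)[OF V f], of "1 / c" c] c by simp
  then have "c * Q f \<le> Q (\<lambda>i. c * f i)"
    using c by (simp add: field_simps)
  then show ?thesis
    using sublinear_onD(2)[OF Q f c] by simp
qed

lemma sublinear_neg_le:
  assumes V: "function_space V" and Q: "sublinear_on V Q" and f: "f \<in> V"
  shows "- Q (\<lambda>i. - f i) \<le> Q f"
  using sublinear_onD(1)[OF Q f function_spaceD(4)[OF V f]] sublinear_zero[OF V Q] by simp

text \<open>
  Zorn's lemma needs lower bounds of chains: the pointwise infimum exists because each member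
  satisfies \<open>Q f \<ge> - Q (- f) \<ge> - P (- f)\<close>, a bound that depends on \<open>P\<close> alone.
\<close>

lemma sublinear_chain_Inf:
  assumes V: "function_space V" and ne: "C \<noteq> {}"
    and C: "\<And>Q. Q \<in> C \<Longrightarrow> sublinear_on V Q" "\<And>Q f. Q \<in> C \<Longrightarrow> f \<in> V \<Longrightarrow> Q f \<le> P f"
    and chain: "\<And>Q R. Q \<in> C \<Longrightarrow> R \<in> C \<Longrightarrow> Q \<le> R \<or> R \<le> Q"
  defines "u \<equiv> \<lambda>f. if f \<in> V then INF Q\<in>C. Q f else 0"
  shows "sublinear_on V u" and "\<And>Q f. Q \<in> C \<Longrightarrow> f \<in> V \<Longrightarrow> u f \<le> Q f"
proof -
  note V' = function_spaceD[OF V]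
  have bdd: "bdd_below ((\<lambda>Q. Q f) ` C)" if "f \<in> V" for f
  proof (rule bdd_belowI2)
    fix Q assume "Q \<in> C"
    then show "- P (\<lambda>i. - f i) \<le> Q f"
      using sublinear_neg_le[OF V C(1) that] C(2)[OF _ V'(4)[OF that]] by fastforce
  qed
  show le: "u f \<le> Q f" if "Q \<in> C" "f \<in> V" for Q f
    using that bdd[OF that(2)] by (auto simp: u_def intro: cINF_lower)
  have ge: "z \<le> u f" if "f \<in> V" "\<And>Q. Q \<in> C \<Longrightarrow> z \<le> Q f" for z f
    using that ne by (auto simp: u_def intro: cINF_greatest)
  show "sublinear_on V u"
    unfolding sublinear_on_def
  proof (intro conjI ballI allI impI)
    fix f g assume f: "f \<in> V" and g: "g \<in> V"
    have sum: "u (\<lambda>i. f i + g i) \<le> Q f + R g" if QR: "Q \<in> C" "R \<in> C" for Q R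
    proof -
      obtain S where S: "S \<in> C" "S \<le> Q" "S \<le> R"
        using chain[OF QR] QR by auto
      have "u (\<lambda>i. f i + g i) \<le> S f + S g"
        using le[OF S(1) V'(2)[OF f g]] sublinear_onD(1)[OF C(1)[OF S(1)] f g] by simp
      then show ?thesis
        using le_funD[OF S(2), of f] le_funD[OF S(3), of g] by linarith
    qed
    have "u (\<lambda>i. f i + g i) - Q f \<le> u g" if "Q \<in> C" for Q
      using sum[OF that] by (intro ge g) (simp add: algebra_simps)
    then have "u (\<lambda>i. f i + g i) - u g \<le> u f"
      by (intro ge f) (simp add: algebra_simps)
    then show "u (\<lambda>i. f i + g i) \<le> u f + u g" by simp
  next
    fix f and c :: real assume f: "f \<in> V" and c: "c > 0"
    have "u (\<lambda>i. c * f i) / c \<le> u f"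
    proof (rule ge[OF f])
      fix Q assume Q: "Q \<in> C"
      show "u (\<lambda>i. c * f i) / c \<le> Q f"
        using le[OF Q V'(3)[OF f], of c] sublinear_onD(2)[OF C(1)[OF Q] f c] c
        by (simp add: field_simps)
    qed
    then show "u (\<lambda>i. c * f i) \<le> c * u f"
      using c by (simp add: field_simps)
  qed
qed

text \<open>
  The functional \<open>S' f = inf {S (f + t y) - t S y | t \<ge> 0}\<close> is again sublinear and lies below \<open>S\<close>. For
  a minimal \<open>S\<close> it must equal \<open>S\<close>, and \<open>t = 1\<close> then gives the superadditivity
  \<open>S f + S y \<le> S (f + y)\<close> that makes \<open>S\<close> linear.
\<close>

lemma sublinear_shear:
  assumes V: "function_space V" and S: "sublinear_on V S" and y: "y \<in> V"
  obtains S' where "sublinear_on V S'" "\<And>f. f \<notin> V \<Longrightarrow> S' f = 0"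
    "\<And>f t. f \<in> V \<Longrightarrow> t \<ge> 0 \<Longrightarrow> S' f \<le> S (\<lambda>i. f i + t * y i) - t * S y"
proof -
  define S' where "S' f = (if f \<in> V then INF t\<in>{0..}. S (\<lambda>i. f i + t * y i) - t * S y else 0)" for f
  note V' = function_spaceD[OF V]
  have bdd: "bdd_below ((\<lambda>t. S (\<lambda>i. f i + t * y i) - t * S y) ` {0..})" if f: "f \<in> V" for f
  proof (rule bdd_belowI2)
    fix t :: real assume t: "t \<in> {0..}"
    have "S (\<lambda>i. (f i + t * y i) + - f i) \<le> S (\<lambda>i. f i + t * y i) + S (\<lambda>i. - f i)"
      by (intro sublinear_onD(1)[OF S] V' f y)
    moreover have "S (\<lambda>i. (f i + t * y i) + - f i) = t * S y"
      using sublinear_homogeneous[OF V S y, of t] t by simp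
    ultimately show "- S (\<lambda>i. - f i) \<le> S (\<lambda>i. f i + t * y i) - t * S y" by simp
  qed
  have le: "S' f \<le> S (\<lambda>i. f i + t * y i) - t * S y" if "f \<in> V" "t \<ge> 0" for f t
    using that bdd[OF that(1)] by (auto simp: S'_def intro!: cINF_lower)
  have ge: "z \<le> S' f" if "f \<in> V" "\<And>t. t \<ge> 0 \<Longrightarrow> z \<le> S (\<lambda>i. f i + t * y i) - t * S y" for z f
    unfolding S'_def using that by (auto intro!: cINF_greatest)
  have "sublinear_on V S'"
    unfolding sublinear_on_def
  proof (intro conjI ballI allI impI)
    fix f g assume f: "f \<in> V" and g: "g \<in> V"
    have sum: "S' (\<lambda>i. f i + g i) \<le>
        (S (\<lambda>i. f i + s * y i) - s * S y) + (S (\<lambda>i. g i + t * y i) - t * S y)"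
      if "s \<ge> 0" "t \<ge> 0" for s t
    proof -
      have "S' (\<lambda>i. f i + g i) \<le> S (\<lambda>i. f i + g i + (s + t) * y i) - (s + t) * S y"
        using that by (intro le V' f g) auto
      also have "(\<lambda>i. f i + g i + (s + t) * y i) = (\<lambda>i. (f i + s * y i) + (g i + t * y i))"
        by (simp add: algebra_simps)
      also have "S \<dots> \<le> S (\<lambda>i. f i + s * y i) + S (\<lambda>i. g i + t * y i)"
        by (intro sublinear_onD(1)[OF S] V' f g y)
      finally show ?thesis by (simp add: algebra_simps)
    qed
    have "S' (\<lambda>i. f i + g i) - (S (\<lambda>i. f i + s * y i) - s * S y) \<le> S' g" if "s \<ge> 0" for s
      using sum[OF that] by (intro ge g) (simp add: algebra_simps)
    then have "S' (\<lambda>i. f i + g i) - S' g \<le> S' f"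
      by (intro ge f) (simp add: algebra_simps)
    then show "S' (\<lambda>i. f i + g i) \<le> S' f + S' g" by simp
  next
    fix f and c :: real assume f: "f \<in> V" and c: "c > 0"
    have "S' (\<lambda>i. c * f i) / c \<le> S' f"
    proof (rule ge[OF f])
      fix t :: real assume t: "t \<ge> 0"
      have "S' (\<lambda>i. c * f i) \<le> S (\<lambda>i. c * f i + (c * t) * y i) - (c * t) * S y"
        using c t by (intro le V' f) auto
      also have "(\<lambda>i. c * f i + (c * t) * y i) = (\<lambda>i. c * (f i + t * y i))"
        by (simp add: algebra_simps)
      also have "S \<dots> \<le> c * S (\<lambda>i. f i + t * y i)"
        by (intro sublinear_onD(2)[OF S] V' f y c)
      finally show "S' (\<lambda>i. c * f i) / c \<le> S (\<lambda>i. f i + t * y i) - t * S y"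
        using c by (simp add: field_simps)
    qed
    then show "S' (\<lambda>i. c * f i) \<le> c * S' f"
      using c by (simp add: field_simps)
  qed
  moreover have "S' f = 0" if "f \<notin> V" for f
    using that by (simp add: S'_def)
  ultimately show thesis using le that by blast
qed

text \<open>
  The Hahn-Banach theorem in the form without a subspace: prescribed values on a subspace are encoded
  in the choice of \<open>P\<close>.
\<close>

theorem sublinear_dominates_linear:
  assumes V: "function_space V" and P: "sublinear_on V P"
  obtains \<Lambda> where "linear_functional_on V \<Lambda>" "\<And>f. f \<in> V \<Longrightarrow> \<Lambda> f \<le> P f"
proof -
  note V' = function_spaceD[OF V]
  \<comment> \<open>With free values outside \<open>V\<close>, chains might have no lower bound in the pointwise order; they are set to \<open>0\<close>.\<close>
  define A where "A = {Q. sublinear_on V Q \<and> (\<forall>f\<in>V. Q f \<le> P f) \<and> (\<forall>f. f \<notin> V \<longrightarrow> Q f = 0)}"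
  have "\<exists>m\<in>A. \<forall>Q\<in>A. m \<ge> Q \<longrightarrow> Q = m"
  proof (rule predicate_Zorn)
    show "partial_order_on A (relation_of (\<ge>) A)"
      by (rule partial_order_on_relation_ofI) auto
    fix C assume C: "C \<in> Chains (relation_of (\<ge>) A)"
    have CA: "C \<subseteq> A" using C by (rule Chains_relation_of)
    have chain: "\<And>Q R. Q \<in> C \<Longrightarrow> R \<in> C \<Longrightarrow> Q \<le> R \<or> R \<le> Q"
      using C by (auto simp: Chains_def relation_of_def)
    show "\<exists>u\<in>A. \<forall>Q\<in>C. Q \<ge> u"
    proof (cases "C = {}")
      case True
      have "(\<lambda>f. if f \<in> V then P f else 0) \<in> A"
        using P V' by (auto simp: A_def sublinear_on_def)
      then show ?thesis using True by blast
    next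
      case False
      let ?u = "\<lambda>f. if f \<in> V then INF Q\<in>C. Q f else 0"
      have CA': "sublinear_on V Q" "\<And>f. f \<in> V \<Longrightarrow> Q f \<le> P f" "\<And>f. f \<notin> V \<Longrightarrow> Q f = 0"
        if "Q \<in> C" for Q
        using CA that by (auto simp: A_def)
      have u: "sublinear_on V ?u" "\<And>Q f. Q \<in> C \<Longrightarrow> f \<in> V \<Longrightarrow> ?u f \<le> Q f"
        using sublinear_chain_Inf[of V C P, OF V False] CA' chain by auto
      have "?u f \<le> P f" if f: "f \<in> V" for f
      proof -
        obtain Q where "Q \<in> C" using False by blast
        then show ?thesis using u(2)[of Q f] CA'(2)[of Q f] f by linarith
      qed
      then have "?u \<in> A"
        using u(1) by (auto simp: A_def)
      moreover have "\<forall>Q\<in>C. Q \<ge> ?u"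
      proof (intro ballI le_funI)
        show "?u f \<le> Q f" if Q: "Q \<in> C" for Q f
          using u(2)[OF Q, of f] CA'(3)[OF Q, of f] by (cases "f \<in> V") simp_all
      qed
      ultimately show ?thesis by blast
    qed
  qed
  then obtain S where S: "S \<in> A" and min: "\<And>Q. Q \<in> A \<Longrightarrow> Q \<le> S \<Longrightarrow> Q = S" by blast
  have sub: "sublinear_on V S" and SP: "\<And>f. f \<in> V \<Longrightarrow> S f \<le> P f" and S0: "\<And>f. f \<notin> V \<Longrightarrow> S f = 0"
    using S by (auto simp: A_def)
  have add: "S (\<lambda>i. f i + y i) = S f + S y" if f: "f \<in> V" and y: "y \<in> V" for f y
  proof -
    obtain S' where S': "sublinear_on V S'" "\<And>g. g \<notin> V \<Longrightarrow> S' g = 0"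
      "\<And>g t. g \<in> V \<Longrightarrow> t \<ge> 0 \<Longrightarrow> S' g \<le> S (\<lambda>i. g i + t * y i) - t * S y"
      using sublinear_shear[OF V sub y] by blast
    have le: "S' g \<le> S g" if "g \<in> V" for g
      using S'(3)[OF that, of 0] by simp
    have "S' g \<le> P g" if "g \<in> V" for g
      using le[OF that] SP[OF that] by simp
    then have "S' \<in> A"
      using S'(1) S'(2) by (simp add: A_def)
    moreover have "S' \<le> S"
    proof (rule le_funI)
      show "S' g \<le> S g" for g
        by (cases "g \<in> V") (simp_all add: le S'(2) S0)
    qed
    ultimately have "S' = S" by (rule min)
    then have "S f \<le> S (\<lambda>i. f i + y i) - S y"
      using S'(3)[OF f, of 1] by simp
    then show ?thesis
      using sublinear_onD(1)[OF sub f y] by simp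
  qed
  have "S (\<lambda>i. c * f i) = c * S f" if f: "f \<in> V" for f c
  proof (cases "c \<ge> 0")
    case True
    then show ?thesis by (rule sublinear_homogeneous[OF V sub f])
  next
    case False
    have "S (\<lambda>i. c * f i + (- c) * f i) = S (\<lambda>i. c * f i) + S (\<lambda>i. (- c) * f i)"
      by (intro add V' f)
    moreover have "S (\<lambda>i. (- c) * f i) = - c * S f"
      using False by (intro sublinear_homogeneous[OF V sub f]) simp
    ultimately show ?thesis
      using sublinear_zero[OF V sub] by simp
  qed
  then have "linear_functional_on V S"
    using add by (auto simp: linear_functional_on_def)
  then show thesis using SP that by blast
qed

section \<open>A space-filling curve\<close>

lemma binary_expansion:
  fixes x :: real
  assumes "x \<in> {0..1}"
  obtains a :: "nat \<Rightarrow> real" where "range a \<subseteq> {0, 1}" "(\<lambda>k. a k / 2 ^ Suc k) sums x"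
proof -
  define r :: "nat \<Rightarrow> real" where
    "r = rec_nat x (\<lambda>_ y. 2 * y - (if y \<ge> 1/2 then 1 else 0))"
  define a :: "nat \<Rightarrow> real" where "a k = (if r k \<ge> 1/2 then 1 else 0)" for k
  have r: "r 0 = x" "r (Suc k) = 2 * r k - a k" for k
    by (simp_all add: r_def a_def)
  have r01: "r k \<in> {0..1}" for k
    by (induction k) (use assms in \<open>auto simp: r a_def\<close>)
  have "(\<Sum>k<n. a k / 2 ^ Suc k) = x - r n / 2 ^ n" for n
    by (induction n) (auto simp: r field_simps)
  moreover have "(\<lambda>n. r n / 2 ^ n) \<longlonglongrightarrow> 0"
  proof (rule Lim_null_comparison)
    show "\<forall>\<^sub>F n in sequentially. norm (r n / 2 ^ n) \<le> (1/2) ^ n"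
    proof (intro always_eventually allI)
      show "norm (r n / 2 ^ n) \<le> (1/2) ^ n" for n
        using r01[of n] by (simp add: power_one_over divide_simps)
    qed
    show "(\<lambda>n. (1/2) ^ n :: real) \<longlonglongrightarrow> 0"
      by (rule LIMSEQ_power_zero) simp
  qed
  ultimately have "(\<lambda>k. a k / 2 ^ Suc k) sums x"
    unfolding sums_def using tendsto_diff[OF tendsto_const, of "\<lambda>n. r n / 2 ^ n" 0 sequentially x] by simp
  moreover have "range a \<subseteq> {0, 1}" by (auto simp: a_def)
  ultimately show thesis using that by blast
qed

text \<open>
  A continuous function of period 2 that vanishes on \<open>[0, 1/3]\<close> and is 1 on \<open>[2/3, 1]\<close>: on a
  number whose ternary digits are 0 and 2, it tells which of the two comes first.
\<close>

definition clipped_cosine :: "real \<Rightarrow> real" where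
  "clipped_cosine s = max 0 (min 1 (1/2 - cos (pi * s)))"

lemma clipped_cosine_period: "clipped_cosine (s + 2 * real n) = clipped_cosine s"
proof -
  have "cos (pi * (s + 2 * real n)) = cos (pi * s + 2 * real n * pi)"
    by (simp add: algebra_simps)
  also have "\<dots> = cos (pi * s)"
    using sin_2npi[of n] by (simp only: cos_add cos_2npi)
  finally show ?thesis by (simp add: clipped_cosine_def)
qed

lemma clipped_cosine_low:
  assumes "s \<in> {0..1/3}" shows "clipped_cosine s = 0"
proof -
  have "cos (pi / 3) \<le> cos (pi * s)"
    using assms by (intro cos_monotone_0_pi_le) (auto simp: field_simps)
  then show ?thesis by (simp add: clipped_cosine_def cos_60)
qed

lemma clipped_cosine_high:
  assumes "s \<in> {2/3..1}" shows "clipped_cosine s = 1"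
proof -
  have "cos (pi / 3) \<le> cos (pi - pi * s)"
    using assms by (intro cos_monotone_0_pi_le) (auto simp: field_simps)
  then show ?thesis by (simp add: clipped_cosine_def cos_60)
qed

text \<open>
  Schoenberg's observation: multiplying \<open>t = \<Sum>j. 2 a\<^sub>j / 3^(j+1)\<close> by \<open>3^i\<close> produces an even integer plus
  the number with the shifted digits, so by periodicity \<open>clipped_cosine\<close> sees the digit \<open>a\<^sub>i\<close>. Any
  sequence of binary digits is thus encoded by one point of the Cantor set and decoded continuously.
\<close>

lemma clipped_cosine_reads_digit:
  fixes a :: "nat \<Rightarrow> real"
  assumes a: "range a \<subseteq> {0, 1}"
  obtains t where "t \<in> {0..1}" "\<And>i. clipped_cosine (3 ^ i * t) = a i"
proof -
  define \<tau> :: "(nat \<Rightarrow> real) \<Rightarrow> real" where "\<tau> b = (\<Sum>j. b j * (2/3) * (1/3) ^ j)" for b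
  have geo: "(\<lambda>j. (2/3) * (1/3) ^ j) sums (1::real)"
    using sums_mult[OF geometric_sums[of "1/3::real"], of "2/3"] by simp
  have summ: "summable (\<lambda>j. b j * (2/3) * (1/3) ^ j)" if "range b \<subseteq> {0, 1}" for b :: "nat \<Rightarrow> real"
  proof (rule summable_comparison_test')
    show "summable (\<lambda>j. (2/3) * (1/3) ^ j :: real)" using geo by (rule sums_summable)
    fix j :: nat
    have "b j \<in> {0, 1}" using that by auto
    then show "norm (b j * (2/3) * (1/3) ^ j) \<le> (2/3) * (1/3) ^ j" by auto
  qed
  have \<tau>01: "\<tau> b \<in> {0..1}" if b: "range b \<subseteq> {0, 1}" for b
  proof -
    have b': "b j \<in> {0, 1}" for j using b by auto
    have "0 \<le> \<tau> b"
      unfolding \<tau>_def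
    proof (intro suminf_nonneg summ b)
      show "0 \<le> b j * (2/3) * (1/3) ^ j" for j
        using b'[of j] by auto
    qed
    moreover have "\<tau> b \<le> (\<Sum>j. (2/3) * (1/3) ^ j)"
      unfolding \<tau>_def
    proof (intro suminf_le summ b sums_summable[OF geo])
      show "b j * (2/3) * (1/3) ^ j \<le> (2/3) * (1/3) ^ j" for j
        using b'[of j] by auto
    qed
    ultimately show ?thesis using sums_unique[OF geo] by simp
  qed
  have shift: "\<tau> b = b 0 * (2/3) + \<tau> (\<lambda>j. b (Suc j)) / 3" if b: "range b \<subseteq> {0, 1}" for b
  proof -
    have b': "range (\<lambda>j. b (Suc j)) \<subseteq> {0, 1}" using b by auto
    have "\<tau> b = b 0 * (2/3) + (\<Sum>j. b (Suc j) * (2/3) * (1/3) ^ Suc j)"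
      unfolding \<tau>_def using suminf_split_head[OF summ[OF b]] by simp
    also have "(\<Sum>j. b (Suc j) * (2/3) * (1/3) ^ Suc j) = (\<Sum>j. (1/3) * (b (Suc j) * (2/3) * (1/3) ^ j))"
      by (simp add: mult_ac)
    also have "\<dots> = \<tau> (\<lambda>j. b (Suc j)) / 3"
      unfolding \<tau>_def using suminf_mult[OF summ[OF b'], of "1/3"] by simp
    finally show ?thesis .
  qed
  have rng: "range (\<lambda>j. a (j + i)) \<subseteq> {0, 1}" for i using a by auto
  have "\<exists>n::nat. 3 ^ i * \<tau> a = 2 * real n + \<tau> (\<lambda>j. a (j + i))" for i
  proof (induction i)
    case 0
    show ?case by (rule exI[of _ 0]) simp
  next
    case (Suc i)
    then obtain n :: nat where n: "3 ^ i * \<tau> a = 2 * real n + \<tau> (\<lambda>j. a (j + i))" by blast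
    have "a i \<in> {0, 1}" using a by auto
    then obtain m :: nat where m: "a i = real m"
      by (metis emptyE insertE of_nat_0 of_nat_1)
    have "3 ^ Suc i * \<tau> a = 2 * real (3 * n + m) + \<tau> (\<lambda>j. a (j + Suc i))"
      using n shift[OF rng[of i]] m by simp
    then show ?case by blast
  qed
  then have "clipped_cosine (3 ^ i * \<tau> a) = clipped_cosine (\<tau> (\<lambda>j. a (j + i)))" for i
    using clipped_cosine_period by (metis add.commute)
  moreover have "clipped_cosine (\<tau> (\<lambda>j. a (j + i))) = a i" for i
  proof -
    have s: "\<tau> (\<lambda>j. a (j + i)) = a i * (2/3) + \<tau> (\<lambda>j. a (j + Suc i)) / 3"
      using shift[OF rng[of i]] by simp
    have "a i \<in> {0, 1}" using a by auto
    then show ?thesis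
      using s \<tau>01[OF rng[of "Suc i"]] clipped_cosine_low clipped_cosine_high by auto
  qed
  ultimately show thesis using that[of "\<tau> a"] \<tau>01[OF a] by simp
qed

text \<open>
  Each coordinate of the curve is assembled from its own subsequence of digits, interleaved modulo the
  dimension; the series of continuous functions converges uniformly.
\<close>

lemma space_filling_curve:
  fixes K :: "'a::euclidean_space set"
  assumes "bounded K"
  obtains h :: "real \<Rightarrow> 'a" where "continuous_on UNIV h" "K \<subseteq> h ` {0..1}"
proof -
  obtain R where R: "\<And>x. x \<in> K \<Longrightarrow> norm x \<le> R" "R > 0"
    using assms by (meson bounded_pos)
  obtain idx :: "'a \<Rightarrow> nat" where idx: "bij_betw idx Basis {..<DIM('a)}"
    by (metis ex_bij_betw_finite_nat finite_Basis lessThan_atLeast0)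
  define c :: "'a \<Rightarrow> real \<Rightarrow> real" where
    "c b t = (\<Sum>k. clipped_cosine (3 ^ (k * DIM('a) + idx b) * t) / 2 ^ Suc k)" for b t
  have "continuous_on UNIV (c b)" for b
  proof -
    have "uniform_limit UNIV (\<lambda>n t. \<Sum>k<n. clipped_cosine (3 ^ (k * DIM('a) + idx b) * t) / 2 ^ Suc k) (c b) sequentially"
      unfolding c_def
    proof (rule Weierstrass_m_test)
      show "summable (\<lambda>k. (1/2) ^ Suc k :: real)" by simp
      show "norm (clipped_cosine (3 ^ (k * DIM('a) + idx b) * t) / 2 ^ Suc k) \<le> (1/2) ^ Suc k" for k t
        by (simp add: clipped_cosine_def field_simps abs_if power_one_over)
    qed
    then show ?thesis
    proof (rule uniform_limit_theorem[rotated])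
      show "\<forall>\<^sub>F n in sequentially. continuous_on UNIV (\<lambda>t. \<Sum>k<n. clipped_cosine (3 ^ (k * DIM('a) + idx b) * t) / 2 ^ Suc k)"
        unfolding clipped_cosine_def by (intro always_eventually allI continuous_intros) simp
    qed simp
  qed
  then have cont: "continuous_on UNIV (\<lambda>t. \<Sum>b\<in>Basis. (R * (2 * c b t - 1)) *\<^sub>R b)"
    by (intro continuous_intros) auto
  have "x \<in> (\<lambda>t. \<Sum>b\<in>Basis. (R * (2 * c b t - 1)) *\<^sub>R b) ` {0..1}" if x: "x \<in> K" for x
  proof -
    have "\<exists>a :: nat \<Rightarrow> real. range a \<subseteq> {0, 1} \<and> (\<lambda>k. a k / 2 ^ Suc k) sums ((x \<bullet> b / R + 1) / 2)"
      if "b \<in> Basis" for b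
    proof -
      have "\<bar>x \<bullet> b\<bar> \<le> R"
        using Basis_le_norm[OF that, of x] R(1)[OF x] by simp
      then have "(x \<bullet> b / R + 1) / 2 \<in> {0..1}"
        using R(2) by (auto simp: field_simps)
      then show ?thesis by (rule binary_expansion) blast
    qed
    then obtain a :: "'a \<Rightarrow> nat \<Rightarrow> real" where
      a: "\<And>b. b \<in> Basis \<Longrightarrow> range (a b) \<subseteq> {0, 1}"
         "\<And>b. b \<in> Basis \<Longrightarrow> (\<lambda>k. a b k / 2 ^ Suc k) sums ((x \<bullet> b / R + 1) / 2)"
      by metis
    define d where "d i = a (inv_into Basis idx (i mod DIM('a))) (i div DIM('a))" for i
    have inv: "inv_into Basis idx (i mod DIM('a)) \<in> Basis" for i
      using idx by (intro inv_into_into) (auto simp: bij_betw_def)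
    have "range d \<subseteq> {0, 1}"
      using a(1)[OF inv] unfolding d_def by blast
    then obtain t where t: "t \<in> {0..1}" "\<And>i. clipped_cosine (3 ^ i * t) = d i"
      using clipped_cosine_reads_digit by blast
    have "c b t = (x \<bullet> b / R + 1) / 2" if b: "b \<in> Basis" for b
    proof -
      have "idx b < DIM('a)" using idx b by (auto simp: bij_betw_def)
      then have "d (k * DIM('a) + idx b) = a b k" for k
        using idx b by (simp add: d_def bij_betw_def)
      then show ?thesis
        unfolding c_def t(2) using sums_unique[OF a(2)[OF b]] by simp
    qed
    then have "R * (2 * c b t - 1) = x \<bullet> b" if "b \<in> Basis" for b
      using that R(2) by (simp add: field_simps)
    then have "(\<Sum>b\<in>Basis. (R * (2 * c b t - 1)) *\<^sub>R b) = (\<Sum>b\<in>Basis. (x \<bullet> b) *\<^sub>R b)"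
      by simp
    then show ?thesis
      using t(1) by (auto simp: euclidean_representation intro!: image_eqI[of _ _ t])
  qed
  then show thesis using cont that by blast
qed

section \<open>Riesz representation of functionals on bounded functions\<close>

definition bounded_functions :: "'i set \<Rightarrow> ('i \<Rightarrow> real) set" where
  "bounded_functions K = {f. bounded (f ` K)}"

lemma function_space_bounded_functions: "function_space (bounded_functions K)"
  unfolding function_space_def
proof (intro conjI ballI allI)
  show "(\<lambda>_. 0) \<in> bounded_functions K"
    by (auto simp: bounded_functions_def bounded_iff)
next
  fix f g assume "f \<in> bounded_functions K" "g \<in> bounded_functions K"
  then obtain A B where "\<And>x. x \<in> K \<Longrightarrow> \<bar>f x\<bar> \<le> A" "\<And>x. x \<in> K \<Longrightarrow> \<bar>g x\<bar> \<le> B"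
    by (auto simp: bounded_functions_def bounded_iff)
  then show "(\<lambda>i. f i + g i) \<in> bounded_functions K"
    unfolding bounded_functions_def bounded_iff
    by (auto intro!: exI[of _ "A + B"] order_trans[OF abs_triangle_ineq] add_mono)
next
  fix f and c :: real assume "f \<in> bounded_functions K"
  then obtain A where "\<And>x. x \<in> K \<Longrightarrow> \<bar>f x\<bar> \<le> A"
    by (auto simp: bounded_functions_def bounded_iff)
  then show "(\<lambda>i. c * f i) \<in> bounded_functions K"
    unfolding bounded_functions_def bounded_iff
    by (auto simp: abs_mult intro!: exI[of _ "\<bar>c\<bar> * A"] mult_left_mono)
qed

lemma bounded_functionsI: "(\<And>x. x \<in> K \<Longrightarrow> \<bar>f x\<bar> \<le> B) \<Longrightarrow> f \<in> bounded_functions K"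
  unfolding bounded_functions_def bounded_iff by auto

lemma continuous_in_bounded_functions:
  assumes "compact K" "continuous_on K f" shows "f \<in> bounded_functions K"
  using compact_imp_bounded[OF compact_continuous_image[OF assms(2,1)]]
  by (simp add: bounded_functions_def)

lemma linear_functional_on_sum:
  fixes n :: nat
  assumes V: "function_space V" and \<Lambda>: "linear_functional_on V \<Lambda>" and f: "\<And>j. f j \<in> V"
  shows "(\<lambda>x. \<Sum>j<n. c j * f j x) \<in> V"
    and "\<Lambda> (\<lambda>x. \<Sum>j<n. c j * f j x) = (\<Sum>j<n. c j * \<Lambda> (f j))"
proof -
  have "(\<lambda>x. \<Sum>j<n. c j * f j x) \<in> V \<and> \<Lambda> (\<lambda>x. \<Sum>j<n. c j * f j x) = (\<Sum>j<n. c j * \<Lambda> (f j))"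
  proof (induction n)
    case 0
    show ?case
      using function_spaceD(1)[OF V] linear_functional_onD(2)[OF \<Lambda> function_spaceD(1)[OF V], of 0] by simp
  next
    case (Suc n)
    have cf: "(\<lambda>x. c n * f n x) \<in> V" by (intro function_spaceD(3)[OF V] f)
    show ?case
      using Suc function_spaceD(2)[OF V _ cf] linear_functional_onD(1)[OF \<Lambda> _ cf]
        linear_functional_onD(2)[OF \<Lambda> f, of "c n" n] by simp
  qed
  then show "(\<lambda>x. \<Sum>j<n. c j * f j x) \<in> V"
    and "\<Lambda> (\<lambda>x. \<Sum>j<n. c j * f j x) = (\<Sum>j<n. c j * \<Lambda> (f j))" by auto
qed

text \<open>
  Positivity is expressed through nonpositive functions, the form in which a linear functional
  below a sublinear one delivers it.
\<close>

definition positive_functional :: "'i set \<Rightarrow> (('i \<Rightarrow> real) \<Rightarrow> real) \<Rightarrow> bool" where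
  "positive_functional K \<Lambda> \<longleftrightarrow> linear_functional_on (bounded_functions K) \<Lambda> \<and>
     (\<forall>f\<in>bounded_functions K. (\<forall>x\<in>K. f x \<le> 0) \<longrightarrow> \<Lambda> f \<le> 0)"

lemma positive_functional_mono:
  assumes \<Lambda>: "positive_functional K \<Lambda>"
    and f: "f \<in> bounded_functions K" and g: "g \<in> bounded_functions K"
    and le: "\<And>x. x \<in> K \<Longrightarrow> f x \<le> g x"
  shows "\<Lambda> f \<le> \<Lambda> g"
proof -
  note V = function_spaceD[OF function_space_bounded_functions[of K]]
  have lin: "linear_functional_on (bounded_functions K) \<Lambda>"
    using \<Lambda> by (simp add: positive_functional_def)
  have g': "(\<lambda>x. (-1) * g x) \<in> bounded_functions K" by (rule V(3)[OF g])
  have "\<Lambda> (\<lambda>x. f x + (-1) * g x) \<le> 0"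
    using \<Lambda> V(2)[OF f g'] le by (auto simp: positive_functional_def)
  then show ?thesis
    using linear_functional_onD(1)[OF lin f g'] linear_functional_onD(2)[OF lin g, of "-1"] by simp
qed

lemma positive_functional_cong:
  assumes "positive_functional K \<Lambda>" "f \<in> bounded_functions K" "\<And>x. x \<in> K \<Longrightarrow> f x = g x"
  shows "\<Lambda> f = \<Lambda> g"
proof (rule antisym)
  have "g \<in> bounded_functions K"
    using assms(2,3) by (simp add: bounded_functions_def cong: image_cong)
  then show "\<Lambda> f \<le> \<Lambda> g" "\<Lambda> g \<le> \<Lambda> f"
    using positive_functional_mono[OF assms(1), of f g] positive_functional_mono[OF assms(1), of g f]
      assms(2,3) by simp_all
qed

text \<open>
  A monotone \<open>F\<close> need not be right-continuous; the function of its right limits is, and it agrees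
  with \<open>F\<close> at every continuity point. Intervals with continuity points as ends are all that is needed below.
\<close>

lemma measure_of_monotone_function:
  fixes F :: "real \<Rightarrow> real"
  assumes F: "mono F"
  obtains m :: "real measure" where "sets m = sets borel"
    "\<And>a b. a \<le> b \<Longrightarrow> isCont F a \<Longrightarrow> isCont F b \<Longrightarrow> emeasure m {a<..b} = ennreal (F b - F a)"
proof -
  define G where "G s = (INF r\<in>{s<..}. F r)" for s
  have bdd: "bdd_below (F ` {s<..})" for s
    by (rule bdd_belowI2[of _ "F s"]) (use F in \<open>auto simp: mono_def\<close>)
  have G_le: "G s \<le> F r" if "s < r" for s r
    unfolding G_def using that bdd by (auto intro: cINF_lower)
  have le_G: "z \<le> G s" if "\<And>r. s < r \<Longrightarrow> z \<le> F r" for z s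
    unfolding G_def using that by (intro cINF_greatest) auto
  have mono: "G s \<le> G t" if "s \<le> t" for s t
    using that by (intro le_G G_le) simp
  have right: "continuous (at_right s) G" for s
    unfolding continuous_within
  proof (rule order_tendstoI)
    fix z assume "z < G s"
    then have "z < G t" if "s < t" for t
      using mono[of s t] that by simp
    then show "\<forall>\<^sub>F t in at_right s. z < G t"
      by (auto simp: eventually_at_right_field intro: exI[of _ "s + 1"])
  next
    fix z assume "G s < z"
    then obtain r where r: "s < r" "F r < z"
      unfolding G_def using bdd by (subst (asm) cINF_less_iff) auto
    then have "G t < z" if "t < r" for t
      using G_le[OF that] by simp
    then show "\<forall>\<^sub>F t in at_right s. G t < z"
      using r(1) by (auto simp: eventually_at_right_field)
  qed
  have eq: "G s = F s" if "isCont F s" for s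
  proof (rule antisym)
    have "(F \<longlongrightarrow> F s) (at_right s)"
      using that by (simp add: isCont_def filterlim_at_split)
    then show "G s \<le> F s"
      by (rule tendsto_lowerbound) (auto simp: eventually_at_right_field intro!: exI[of _ "s + 1"] G_le)
    show "F s \<le> G s"
      using F by (intro le_G) (auto simp: mono_def)
  qed
  show thesis
  proof (rule that[of "interval_measure G"])
    fix a b :: real assume "a \<le> b" "isCont F a" "isCont F b"
    then show "emeasure (interval_measure G) {a<..b} = ennreal (F b - F a)"
      by (subst emeasure_interval_measure_Ioc) (auto simp: mono right eq)
  qed simp
qed

lemma sum_indicator_consecutive_intervals:
  fixes s :: "nat \<Rightarrow> real"
  assumes "\<And>i. s i \<le> s (Suc i)"
  shows "(\<Sum>i<n. indicator {s i<..s (Suc i)} u) = (indicator {s 0<..s n} u :: real)"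
proof (induction n)
  case (Suc n)
  have "s 0 \<le> s n" using lift_Suc_mono_le[of s 0 n] assms by simp
  then show ?case using Suc assms[of n] by (auto simp: indicator_def)
qed simp

text \<open>
  Applied to the countable set of discontinuities of a monotone function.
\<close>

lemma grid_avoiding_countable:
  fixes C :: "real set" and \<delta> :: real
  assumes C: "countable C" "a \<notin> C" "b \<notin> C" and ab: "a < b" and \<delta>: "\<delta> > 0"
  obtains s n where "\<And>i. s i \<le> s (Suc i)" "\<And>i. s i \<notin> C" "s 0 = a" "s (n::nat) = b"
    "\<And>i. s (Suc i) - s i < \<delta>"
proof -
  obtain n :: nat where n: "2 * (b - a) / \<delta> < real n" using reals_Archimedean2 by blast
  have "0 < 2 * (b - a) / \<delta>" using ab \<delta> by simp
  then have n0: "n > 0" using n by (cases n) auto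
  define \<eta> where "\<eta> = (b - a) / real n"
  have \<eta>: "\<eta> > 0" "2 * \<eta> < \<delta>" "a + real n * \<eta> = b"
    using n n0 ab \<delta> by (auto simp: \<eta>_def field_simps)
  \<comment> \<open>Shift each inner point of the regular grid by less than half a step; the order is preserved.\<close>
  have "\<exists>x. \<bar>x - (a + real i * \<eta>)\<bar> < \<eta> / 2 \<and> x \<notin> C \<and> (i = 0 \<longrightarrow> x = a) \<and> (i = n \<longrightarrow> x = b)" for i
  proof (cases "i = 0 \<or> i = n")
    case True
    then show ?thesis
      using C(2,3) \<eta> n0 by (auto intro: exI[of _ a] exI[of _ b])
  next
    case False
    have "\<exists>x\<in>{a + real i * \<eta> - \<eta> / 2<..<a + real i * \<eta> + \<eta> / 2}. x \<notin> C"
      using \<eta>(1) by (intro open_minus_countable[OF C(1)]) auto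
    then obtain x where "a + real i * \<eta> - \<eta> / 2 < x" "x < a + real i * \<eta> + \<eta> / 2" "x \<notin> C"
      by auto
    then have "\<bar>x - (a + real i * \<eta>)\<bar> < \<eta> / 2" "x \<notin> C" by arith+
    then show ?thesis using False by blast
  qed
  then obtain s where s: "\<And>i. \<bar>s i - (a + real i * \<eta>)\<bar> < \<eta> / 2" "\<And>i. s i \<notin> C" "s 0 = a" "s n = b"
    by metis
  have step: "s i \<le> s (Suc i) \<and> s (Suc i) - s i < 2 * \<eta>" for i
    using s(1)[of i] s(1)[of "Suc i"] by (simp add: abs_if algebra_simps split: if_splits)
  show thesis
    by (rule that[of s n]) (use s step \<eta>(2) in \<open>auto intro: less_trans\<close>)
qed

text \<open>
  The distribution function \<open>F s = \<Lambda> (indicator {..s} \<circ> e)\<close> makes sense because \<open>\<Lambda>\<close> is defined on all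
  bounded functions. The integral of its Stieltjes measure and the functional \<open>\<phi> \<mapsto> \<Lambda> (\<phi> \<circ> e)\<close> agree
  on step functions over intervals ending at continuity points of \<open>F\<close>, and these approximate
  every continuous function uniformly.
\<close>

lemma positive_functional_on_line:
  fixes e :: "'i \<Rightarrow> real"
  assumes \<Lambda>: "positive_functional K \<Lambda>" and e: "\<And>x. x \<in> K \<Longrightarrow> e x \<in> {0..1}"
  obtains m :: "real measure" where "sets m = sets borel" "finite_measure m"
    "\<And>\<phi>. continuous_on UNIV \<phi> \<Longrightarrow> (\<integral>t. \<phi> t \<partial>m) = \<Lambda> (\<lambda>x. \<phi> (e x))"
proof -
  let ?V = "bounded_functions K"
  note V = function_spaceD[OF function_space_bounded_functions[of K]]
  have lin: "linear_functional_on ?V \<Lambda>"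
    using \<Lambda> by (simp add: positive_functional_def)
  note add = linear_functional_onD(1)[OF lin] and scale = linear_functional_onD(2)[OF lin]
  define F where "F s = \<Lambda> (\<lambda>x. indicator {..s} (e x))" for s :: real
  have ind: "(\<lambda>x. indicator A (e x)) \<in> ?V" for A :: "real set"
    by (rule bounded_functionsI[of _ _ 1]) (simp add: indicator_def)
  have mono: "mono F"
    unfolding F_def
    by (intro monoI positive_functional_mono[OF \<Lambda>] ind) (auto simp: indicator_def)
  have F_low: "F s = 0" if "s < 0" for s
  proof -
    have "F s = \<Lambda> (\<lambda>x. 0 * indicator {..s} (e x))"
      unfolding F_def using e that
      by (intro positive_functional_cong[OF \<Lambda>] ind) (force simp: indicator_def)
    then show ?thesis using scale[OF ind, of 0] by simp
  qed
  have F_high: "F s = F 1" if "s \<ge> 1" for s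
    unfolding F_def using e that
    by (intro positive_functional_cong[OF \<Lambda>] ind) (force simp: indicator_def)
  have cont_low: "isCont F (-1)"
  proof -
    have "continuous_on {..<0} F"
      by (subst continuous_on_cong[OF refl, of _ _ "\<lambda>_. 0"]) (auto simp: F_low)
    then show ?thesis by (simp add: continuous_on_eq_continuous_at)
  qed
  have cont_high: "isCont F 2"
  proof -
    have "continuous_on {1<..} F"
      by (subst continuous_on_cong[OF refl, of _ _ "\<lambda>_. F 1"]) (auto intro: F_high)
    then show ?thesis by (simp add: continuous_on_eq_continuous_at)
  qed
  obtain m0 :: "real measure" where m0: "sets m0 = sets borel"
    "\<And>a b. a \<le> b \<Longrightarrow> isCont F a \<Longrightarrow> isCont F b \<Longrightarrow> emeasure m0 {a<..b} = ennreal (F b - F a)"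
    using measure_of_monotone_function[OF mono] by blast
  \<comment> \<open>\<open>F\<close> is constant outside \<open>{0..1}\<close>, so \<open>-1\<close> and \<open>2\<close> are continuity points and nothing is cut off.\<close>
  define m where "m = density m0 (indicator {-1<..2})"
  have sets_m [measurable_cong, simp]: "sets m = sets borel" by (simp add: m_def m0(1))
  have space_m [simp]: "space m = UNIV" using sets_eq_imp_space_eq[OF sets_m] by simp
  have em: "emeasure m B = emeasure m0 ({-1<..2} \<inter> B)" if "B \<in> sets borel" for B
    unfolding m_def using that m0(1)
    by (subst emeasure_density) (auto simp: indicator_inter_arith[symmetric] intro!: nn_integral_indicator)
  have fin: "finite_measure m"
    by (rule finite_measureI) (simp add: em m0(2) cont_low cont_high)
  interpret finite_measure m by (rule fin)
  have Ioc: "measure m {a<..b} = F b - F a"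
    if "-1 \<le> a" "a \<le> b" "b \<le> 2" "isCont F a" "isCont F b" for a b
  proof -
    have "{-1<..2} \<inter> {a<..b} = {a<..b}" using that by auto
    then have "emeasure m {a<..b} = ennreal (F b - F a)"
      using that by (simp add: em m0(2))
    then show ?thesis
      using monoD[OF mono that(2)] by (simp add: measure_def)
  qed
  have AE_m: "AE t in m. t \<in> {-1<..2}"
    unfolding m_def using m0(1) by (subst AE_density) (auto simp: indicator_def)
  have integrable_m: "integrable m \<phi>" if \<phi>: "continuous_on UNIV \<phi>" for \<phi> :: "real \<Rightarrow> real"
  proof -
    have "bounded (\<phi> ` {-1..2})"
      using \<phi> by (intro compact_imp_bounded compact_continuous_image) (auto intro: continuous_on_subset)
    then obtain B where B: "\<forall>t\<in>{-1..2}. \<bar>\<phi> t\<bar> \<le> B" by (auto simp: bounded_iff)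
    have "AE t in m. norm (\<phi> t) \<le> B" by (rule AE_mp[OF AE_m AE_I2]) (use B in auto)
    moreover have "\<phi> \<in> borel_measurable m"
      using borel_measurable_continuous_onI[OF \<phi>] by (simp cong: measurable_cong_sets)
    ultimately show ?thesis by (rule integrable_const_bound)
  qed
  have approx: "\<bar>(\<integral>t. \<phi> t \<partial>m) - \<Lambda> (\<lambda>x. \<phi> (e x))\<bar> \<le> 2 * F 1 * \<epsilon>"
    if \<phi>: "continuous_on UNIV \<phi>" and \<epsilon>: "\<epsilon> > 0" for \<phi> :: "real \<Rightarrow> real" and \<epsilon>
  proof -
    have "uniformly_continuous_on {-1..2} \<phi>"
      using \<phi> by (intro compact_uniformly_continuous) (auto intro: continuous_on_subset)
    then obtain \<delta> where \<delta>: "\<delta> > 0"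
      "\<And>t u. t \<in> {-1..2} \<Longrightarrow> u \<in> {-1..2} \<Longrightarrow> \<bar>t - u\<bar> < \<delta> \<Longrightarrow> \<bar>\<phi> t - \<phi> u\<bar> < \<epsilon>"
      using \<epsilon> unfolding uniformly_continuous_on_def dist_real_def by metis
    obtain s n where s: "\<And>i. s i \<le> s (Suc i)" "\<And>i. isCont F (s i)" "s 0 = -1" "s (n::nat) = 2"
      "\<And>i. s (Suc i) - s i < \<delta>"
      using grid_avoiding_countable[OF mono_ctble_discont[OF mono], of "-1" 2 \<delta>] cont_low cont_high \<delta>(1)
      by auto
    have mono_s: "s i \<le> s j" if "i \<le> j" for i j
      using lift_Suc_mono_le[of s i j] s(1) that by blast
    define I where "I i = {s i<..s (Suc i)}" for i
    define \<psi> where "\<psi> t = (\<Sum>i<n. \<phi> (s (Suc i)) * indicator (I i) t)" for t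
    have close: "\<bar>\<phi> t - \<psi> t\<bar> \<le> \<epsilon>" if t: "t \<in> {-1<..2}" for t
    proof -
      have one: "(\<Sum>i<n. indicator (I i) t) = (1::real)"
        using sum_indicator_consecutive_intervals[of s t n, OF s(1)] t s(3,4) by (simp add: I_def)
      have "\<phi> t - \<psi> t = (\<Sum>i<n. (\<phi> t - \<phi> (s (Suc i))) * indicator (I i) t)"
        using one by (simp add: \<psi>_def left_diff_distrib sum_subtractf flip: sum_distrib_left)
      also have "\<bar>\<dots>\<bar> \<le> (\<Sum>i<n. \<bar>(\<phi> t - \<phi> (s (Suc i))) * indicator (I i) t\<bar>)"
        by (rule sum_abs)
      also have "\<dots> \<le> (\<Sum>i<n. \<epsilon> * indicator (I i) t)"
      proof (rule sum_mono)
        fix i assume "i \<in> {..<n}"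
        then have "s (Suc i) \<le> 2" "-1 \<le> s (Suc i)"
          using mono_s[of "Suc i" n] mono_s[of 0 "Suc i"] s(3,4) by auto
        then have "\<bar>\<phi> t - \<phi> (s (Suc i))\<bar> \<le> \<epsilon>" if "t \<in> I i"
          using t that s(5)[of i] by (intro less_imp_le \<delta>(2)) (auto simp: I_def)
        then show "\<bar>(\<phi> t - \<phi> (s (Suc i))) * indicator (I i) t\<bar> \<le> \<epsilon> * indicator (I i) t"
          by (auto simp: indicator_def)
      qed
      also have "\<dots> = \<epsilon>" using one by (simp flip: sum_distrib_left)
      finally show ?thesis .
    qed
    have FI: "\<Lambda> (\<lambda>x. indicator (I i) (e x)) = F (s (Suc i)) - F (s i)" for i
    proof -
      have "(\<lambda>x. indicator {..s (Suc i)} (e x) + (-1) * indicator {..s i} (e x)) =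
          (\<lambda>x. indicator (I i) (e x) :: real)"
        using s(1)[of i] by (auto simp: I_def indicator_def fun_eq_iff)
      then show ?thesis
        using add[OF ind V(3)[OF ind], of "{..s (Suc i)}" "-1" "{..s i}"] scale[OF ind, of "-1" "{..s i}"]
        by (simp add: F_def)
    qed
    have I_int: "integrable m (indicator (I i) :: real \<Rightarrow> real)" for i
      by (rule integrable_const_bound[of _ 1]) (auto simp: I_def indicator_def)
    have "(\<integral>t. \<psi> t \<partial>m) = (\<Sum>i<n. \<phi> (s (Suc i)) * measure m (I i))"
      unfolding \<psi>_def by (subst Bochner_Integration.integral_sum) (auto simp: I_int)
    also have "\<dots> = (\<Sum>i<n. \<phi> (s (Suc i)) * (F (s (Suc i)) - F (s i)))"
    proof (intro sum.cong refl)
      fix i assume "i \<in> {..<n}"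
      then show "\<phi> (s (Suc i)) * measure m (I i) = \<phi> (s (Suc i)) * (F (s (Suc i)) - F (s i))"
        using mono_s[of "Suc i" n] mono_s[of 0 i] s unfolding I_def by (subst Ioc) auto
    qed
    also have "\<dots> = \<Lambda> (\<lambda>x. \<psi> (e x))"
      unfolding \<psi>_def
      using linear_functional_on_sum(2)[OF function_space_bounded_functions lin ind, of "\<lambda>i. \<phi> (s (Suc i))" I n]
      by (simp add: FI)
    finally have \<psi>_eq: "(\<integral>t. \<psi> t \<partial>m) = \<Lambda> (\<lambda>x. \<psi> (e x))" .
    have \<psi>_V: "(\<lambda>x. \<psi> (e x)) \<in> ?V"
      unfolding \<psi>_def by (rule linear_functional_on_sum(1)[OF function_space_bounded_functions lin ind])
    have const_V: "(\<lambda>x. c) \<in> ?V" for c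
      by (rule bounded_functionsI[of _ _ "\<bar>c\<bar>"]) simp
    have \<Lambda>_const: "\<Lambda> (\<lambda>x. c) = c * F 1" for c
    proof -
      have "\<Lambda> (\<lambda>x. c) = \<Lambda> (\<lambda>x. c * indicator {..1} (e x))"
        using e by (intro positive_functional_cong[OF \<Lambda>] const_V) (auto simp: indicator_def)
      then show ?thesis using scale[OF ind] by (simp add: F_def)
    qed
    have \<phi>_V: "(\<lambda>x. \<phi> (e x)) \<in> ?V"
    proof -
      have "bounded (\<phi> ` {0..1})"
        using \<phi> by (intro compact_imp_bounded compact_continuous_image) (auto intro: continuous_on_subset)
      then show ?thesis
        unfolding bounded_functions_def by (auto elim!: bounded_subset dest!: e)
    qed
    have close': "\<bar>\<phi> (e x) - \<psi> (e x)\<bar> \<le> \<epsilon>" if "x \<in> K" for x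
      using e[OF that] by (intro close) auto
    have "\<Lambda> (\<lambda>x. \<phi> (e x)) \<le> \<Lambda> (\<lambda>x. \<psi> (e x) + \<epsilon>)"
      using close' by (intro positive_functional_mono[OF \<Lambda>] V \<phi>_V \<psi>_V const_V) (fastforce simp: abs_le_iff)
    moreover have "\<Lambda> (\<lambda>x. \<psi> (e x)) \<le> \<Lambda> (\<lambda>x. \<phi> (e x) + \<epsilon>)"
      using close' by (intro positive_functional_mono[OF \<Lambda>] V \<phi>_V \<psi>_V const_V) (fastforce simp: abs_le_iff)
    ultimately have 1: "\<bar>\<Lambda> (\<lambda>x. \<phi> (e x)) - \<Lambda> (\<lambda>x. \<psi> (e x))\<bar> \<le> \<epsilon> * F 1"
      using add[OF \<psi>_V const_V, of \<epsilon>] add[OF \<phi>_V const_V, of \<epsilon>] by (simp add: \<Lambda>_const)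
    have \<psi>_int: "integrable m \<psi>"
      unfolding \<psi>_def by (intro Bochner_Integration.integrable_sum integrable_mult_right I_int)
    have "\<bar>(\<integral>t. \<phi> t \<partial>m) - (\<integral>t. \<psi> t \<partial>m)\<bar> = \<bar>\<integral>t. \<phi> t - \<psi> t \<partial>m\<bar>"
      by (simp add: Bochner_Integration.integral_diff[OF integrable_m[OF \<phi>] \<psi>_int])
    also have "\<dots> \<le> (\<integral>t. \<bar>\<phi> t - \<psi> t\<bar> \<partial>m)" by (rule integral_abs_bound)
    also have "\<dots> \<le> (\<integral>t. \<epsilon> \<partial>m)"
      using AE_m close
      by (intro integral_mono_AE integrable_abs Bochner_Integration.integrable_diff integrable_m[OF \<phi>] \<psi>_int) auto
    also have "\<dots> = \<epsilon> * F 1"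
    proof -
      have "emeasure m UNIV = emeasure m {-1<..2}"
        by (simp add: em)
      then have "measure m UNIV = measure m {-1<..2}" by (simp add: measure_def)
      then show ?thesis
        using Ioc[OF _ _ _ cont_low cont_high] F_low[of "-1"] F_high[of 2] by simp
    qed
    finally show ?thesis using 1 \<psi>_eq by (simp add: algebra_simps)
  qed
  have "(\<integral>t. \<phi> t \<partial>m) = \<Lambda> (\<lambda>x. \<phi> (e x))" if \<phi>: "continuous_on UNIV \<phi>" for \<phi> :: "real \<Rightarrow> real"
  proof -
    have "0 \<le> F 1" using F_low[of "-1"] monoD[OF mono, of "-1" 1] by simp
    have "\<bar>(\<integral>t. \<phi> t \<partial>m) - \<Lambda> (\<lambda>x. \<phi> (e x))\<bar> \<le> 0 + \<epsilon>" if "\<epsilon> > 0" for \<epsilon>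
    proof -
      have "\<bar>(\<integral>t. \<phi> t \<partial>m) - \<Lambda> (\<lambda>x. \<phi> (e x))\<bar> \<le> 2 * F 1 * (\<epsilon> / (2 * F 1 + 1))"
        using \<open>0 \<le> F 1\<close> that by (intro approx \<phi>) simp
      also have "\<dots> \<le> \<epsilon>"
        using \<open>0 \<le> F 1\<close> that by (simp add: field_simps)
      finally show ?thesis by simp
    qed
    then have "\<bar>(\<integral>t. \<phi> t \<partial>m) - \<Lambda> (\<lambda>x. \<phi> (e x))\<bar> \<le> 0" by (rule field_le_epsilon)
    then show ?thesis by simp
  qed
  then show thesis using that[OF sets_m fin] by blast
qed

text \<open>
  Let \<open>h\<close> be a curve whose image contains \<open>K\<close> and \<open>e\<close> a right inverse of \<open>h\<close> on \<open>K\<close> picked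
  by choice. The measure on the line that represents \<open>\<phi> \<mapsto> \<Lambda> (\<phi> \<circ> e)\<close> is pushed forward
  by \<open>h\<close>: as \<open>h \<circ> e\<close> is the identity on \<open>K\<close>, the result represents \<open>\<Lambda>\<close> on continuous functions.
\<close>

theorem riesz_representation:
  fixes K :: "'a::euclidean_space set"
  assumes K: "compact K" "K \<noteq> {}" and \<Lambda>: "positive_functional K \<Lambda>"
  obtains M where "M \<in> nonneg_measures_on K"
    "\<And>g. continuous_on K g \<Longrightarrow> (\<integral>x. g x \<partial>M) = \<Lambda> g"
proof -
  obtain h :: "real \<Rightarrow> 'a" where h: "continuous_on UNIV h" "K \<subseteq> h ` {0..1}"
    using space_filling_curve[OF compact_imp_bounded[OF K(1)]] by blast
  then obtain e where e: "\<And>x. x \<in> K \<Longrightarrow> e x \<in> {0..1}" "\<And>x. x \<in> K \<Longrightarrow> h (e x) = x"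
    by (metis (no_types, lifting) image_iff subsetD)
  obtain m :: "real measure" where m: "sets m = sets borel" "finite_measure m"
    "\<And>\<phi>. continuous_on UNIV \<phi> \<Longrightarrow> (\<integral>t. \<phi> t \<partial>m) = \<Lambda> (\<lambda>x. \<phi> (e x))"
    using positive_functional_on_line[of K \<Lambda> e, OF \<Lambda> e(1)] by blast
  interpret m: finite_measure m by (rule m(2))
  have h_meas [measurable]: "h \<in> measurable m borel"
    using borel_measurable_continuous_onI[OF h(1)] m(1) by (simp cong: measurable_cong_sets)
  define M where "M = distr m borel h"
  have sets_M [simp]: "sets M = sets borel" by (simp add: M_def)
  have fin: "finite_measure M" unfolding M_def by (rule m.finite_measure_distr) simp
  have int_M: "(\<integral>x. g x \<partial>M) = \<Lambda> g" if g: "continuous_on UNIV g" for g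
  proof -
    have gh: "continuous_on UNIV (\<lambda>t. g (h t))"
      using continuous_on_compose2[OF g h(1)] by simp
    have "(\<integral>x. g x \<partial>M) = (\<integral>t. g (h t) \<partial>m)"
      unfolding M_def using borel_measurable_continuous_onI[OF g] by (subst integral_distr) auto
    also have "\<dots> = \<Lambda> (\<lambda>x. g (h (e x)))" by (rule m(3)[OF gh])
    also have "\<dots> = \<Lambda> g"
      using K(1) g e(2) by (intro positive_functional_cong[OF \<Lambda>, symmetric] continuous_in_bounded_functions)
        (auto intro: continuous_on_subset)
    finally show ?thesis .
  qed
  \<comment> \<open>The curve leaves \<open>K\<close>, but integrating the distance to \<open>K\<close> shows that the measure does not.\<close>
  have AE_K: "AE x in M. x \<in> K"
  proof -
    interpret M: finite_measure M by (rule fin)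
    let ?d = "\<lambda>x. min 1 (infdist x K)"
    have d: "continuous_on UNIV ?d" by (intro continuous_intros)
    have int: "integrable M ?d"
      using borel_measurable_continuous_onI[OF d]
      by (intro M.integrable_const_bound[of _ 1]) (auto simp: infdist_nonneg cong: measurable_cong_sets)
    have "(\<integral>x. ?d x \<partial>M) = \<Lambda> ?d" by (rule int_M[OF d])
    also have "\<dots> = \<Lambda> (\<lambda>x. 0 * ?d x)"
      using K(1) d by (intro positive_functional_cong[OF \<Lambda>] continuous_in_bounded_functions)
        (auto intro: continuous_on_subset)
    also have "\<dots> = 0 * \<Lambda> ?d"
      using \<Lambda> K(1) d unfolding positive_functional_def
      by (intro linear_functional_onD(2)[of "bounded_functions K" \<Lambda> ?d] continuous_in_bounded_functions)
        (auto intro: continuous_on_subset)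
    finally have "AE x in M. ?d x = 0"
      using integral_nonneg_eq_0_iff_AE[OF int] by (simp add: infdist_nonneg)
    then show ?thesis
    proof eventually_elim
      case (elim x)
      then have "infdist x K = 0" by (simp add: min_def split: if_splits)
      then show "x \<in> K"
        using in_closed_iff_infdist_zero[OF compact_imp_closed[OF K(1)] K(2)] by blast
    qed
  qed
  have K_sets: "K \<in> sets borel" using compact_imp_closed[OF K(1)] by auto
  show thesis
  proof (rule that[of "restrict_space M K"])
    show "restrict_space M K \<in> nonneg_measures_on K"
      unfolding nonneg_measures_on_def using K_sets fin
      by (simp add: finite_measure_restrict_space sets_restrict_space)
    fix g :: "'a \<Rightarrow> real" assume g: "continuous_on K g"
    have "closedin (top_of_set UNIV) K" using compact_imp_closed[OF K(1)] by simp
    then obtain G where G: "continuous_on UNIV G" "\<And>x. x \<in> K \<Longrightarrow> G x = g x"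
      using Tietze_unbounded[OF g] by blast
    have G_meas [measurable]: "G \<in> borel_measurable borel" by (rule borel_measurable_continuous_onI[OF G(1)])
    have "(\<integral>x. g x \<partial>restrict_space M K) = (\<integral>x. G x \<partial>restrict_space M K)"
      by (rule Bochner_Integration.integral_cong) (auto simp: space_restrict_space G(2))
    also have "\<dots> = (\<integral>x. indicator K x *\<^sub>R G x \<partial>M)"
      using K_sets by (subst integral_restrict_space) auto
    also have "\<dots> = (\<integral>x. G x \<partial>M)"
      using K_sets AE_K by (intro integral_cong_AE) (auto cong: measurable_cong_sets)
    also have "\<dots> = \<Lambda> G" by (rule int_M[OF G(1)])
    also have "\<dots> = \<Lambda> g"
      using g G K(1) by (intro positive_functional_cong[OF \<Lambda>] continuous_in_bounded_functions)
        (auto intro: continuous_on_subset)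
    finally show "(\<integral>x. g x \<partial>restrict_space M K) = \<Lambda> g" .
  qed
qed

section \<open>Calculus of test functions and integration on compact sets\<close>

text \<open>
  Both differential operators evaluate the total derivative in a direction, which makes their
  linearity in \<open>v\<close> and their continuity evident.
\<close>

lemma derivatives_of_has_derivative:
  fixes v :: "real \<times> (real^'n) \<Rightarrow> real"
  assumes v: "(v has_derivative D) (at z)"
  shows "Lie_deriv f v z = D (1, f z)" and "w \<bullet> grad_x v z = D (0, w)"
proof -
  obtain t x where z: "z = (t, x)" by (cases z)
  interpret D: bounded_linear D using v by (rule has_derivative_bounded_linear)
  have "((\<lambda>s. v (s, x)) has_derivative (\<lambda>h. D (h, 0))) (at t)"
    by (rule has_derivative_compose[where f = "\<lambda>s. (s, x)" and g = v])
      (auto intro!: derivative_eq_intros v[unfolded z])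
  moreover have "D (h, 0) = D (1, 0) * h" for h
    using D.scaleR[of h "(1, 0)"] by (simp add: mult.commute)
  then have "(\<lambda>h. D (h, 0)) = (*) (D (1, 0))" by (rule ext)
  ultimately have "((\<lambda>s. v (s, x)) has_field_derivative D (1, 0)) (at t)"
    unfolding has_field_derivative_def by metis
  then have "time_deriv v z = D (1, 0)"
    by (simp add: z time_deriv_def DERIV_imp_deriv)
  moreover have grad: "w \<bullet> grad_x v z = D (0, w)" for w
  proof -
    have "((\<lambda>y. v (t, y)) has_derivative (\<lambda>h. D (0, h))) (at x)"
      by (rule has_derivative_compose[where f = "\<lambda>y. (t, y)" and g = v])
        (auto intro!: derivative_eq_intros v[unfolded z])
    then have F: "frechet_derivative (\<lambda>y. v (t, y)) (at x) = (\<lambda>h. D (0, h))"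
      by (rule frechet_derivative_at[symmetric])
    have lin: "linear (\<lambda>h. D (0, h))"
      using D.add[of "(0, _)" "(0, _)"] D.scaleR[of _ "(0, _)"] by (intro linearI) simp_all
    have "D (0, w) = D (0, \<Sum>i\<in>UNIV. (w $ i) *\<^sub>R axis i 1)"
      by (simp add: basis_expansion scalar_mult_eq_scaleR[symmetric])
    also have "\<dots> = (\<Sum>i\<in>UNIV. (w $ i) *\<^sub>R D (0, axis i 1))"
      using linear_sum[OF lin, of "\<lambda>i. (w $ i) *\<^sub>R axis i 1" UNIV] linear_scale[OF lin] by simp
    finally show ?thesis
      by (simp add: z grad_x_def inner_vec_def F)
  qed
  ultimately show "Lie_deriv f v z = D (1, f z)"
    unfolding Lie_deriv_def using D.add[of "(1, 0)" "(0, f z)"] by simp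
  show "w \<bullet> grad_x v z = D (0, w)" by (rule grad)
qed

lemma C1_nbhdE:
  assumes "C1_nbhd S v"
  obtains v' where "\<And>z. z \<in> S \<Longrightarrow> (v has_derivative blinfun_apply (v' z)) (at z)"
    "continuous_on S v'" "continuous_on S v"
proof -
  obtain U v' where U: "open U" "S \<subseteq> U" "\<And>z. z \<in> U \<Longrightarrow> (v has_derivative blinfun_apply (v' z)) (at z)"
    "continuous_on U v'"
    using assms unfolding C1_nbhd_def by blast
  have "continuous_on S v"
    using U(2,3) by (intro continuous_at_imp_continuous_on) (blast intro: has_derivative_continuous)
  then show thesis
    using that[of v'] U continuous_on_subset by blast
qed

lemma C1_nbhd_add:
  assumes "C1_nbhd S v" "C1_nbhd S w"
  shows "C1_nbhd S (\<lambda>z. v z + w z)"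
proof -
  obtain U v' where U: "open U" "S \<subseteq> U" "\<And>z. z \<in> U \<Longrightarrow> (v has_derivative blinfun_apply (v' z)) (at z)"
    "continuous_on U v'"
    using assms(1) unfolding C1_nbhd_def by blast
  obtain W w' where W: "open W" "S \<subseteq> W" "\<And>z. z \<in> W \<Longrightarrow> (w has_derivative blinfun_apply (w' z)) (at z)"
    "continuous_on W w'"
    using assms(2) unfolding C1_nbhd_def by blast
  have "((\<lambda>z. v z + w z) has_derivative blinfun_apply (v' z + w' z)) (at z)" if "z \<in> U \<inter> W" for z
    using has_derivative_add[OF U(3) W(3)] that by (simp add: plus_blinfun.rep_eq)
  moreover have "continuous_on (U \<inter> W) (\<lambda>z. v' z + w' z)"
    using U(4) W(4) by (intro continuous_intros) (auto intro: continuous_on_subset)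
  ultimately show ?thesis
    unfolding C1_nbhd_def using U(1,2) W(1,2)
    by (intro exI[of _ "U \<inter> W"] exI[of _ "\<lambda>z. v' z + w' z"]) auto
qed

lemma C1_nbhd_scale:
  assumes "C1_nbhd S v"
  shows "C1_nbhd S (\<lambda>z. c * v z)"
proof -
  obtain U v' where U: "open U" "S \<subseteq> U" "\<And>z. z \<in> U \<Longrightarrow> (v has_derivative blinfun_apply (v' z)) (at z)"
    "continuous_on U v'"
    using assms unfolding C1_nbhd_def by blast
  have "((\<lambda>z. c * v z) has_derivative blinfun_apply (c *\<^sub>R v' z)) (at z)" if "z \<in> U" for z
    using has_derivative_mult_right[OF U(3)[OF that], of c] by (simp add: scaleR_blinfun.rep_eq)
  moreover have "continuous_on U (\<lambda>z. c *\<^sub>R v' z)"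
    using U(4) by (intro continuous_intros)
  ultimately show ?thesis
    unfolding C1_nbhd_def using U(1,2)
    by (intro exI[of _ U] exI[of _ "\<lambda>z. c *\<^sub>R v' z"]) auto
qed

lemma has_derivative_affine_time:
  "((\<lambda>z. a + b * fst z) has_derivative (\<lambda>h. b * fst h)) (at z)"
  for z :: "real \<times> 'a::real_normed_vector"
  by (auto intro!: derivative_eq_intros)

lemma C1_nbhd_affine_time: "C1_nbhd S (\<lambda>z :: real \<times> 'a::real_normed_vector. a + b * fst z)"
proof -
  have bl: "bounded_linear (\<lambda>h :: real \<times> 'a. b * fst h)"
    using has_derivative_affine_time[of 0 b] by (rule has_derivative_bounded_linear)
  show ?thesis
    unfolding C1_nbhd_def
    using has_derivative_affine_time[of a b] bl
    by (intro exI[of _ UNIV] exI[of _ "\<lambda>_. Blinfun (\<lambda>h. b * fst h)"])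
      (auto simp: bounded_linear_Blinfun_apply)
qed

lemma Lie_deriv_affine_time: "Lie_deriv f (\<lambda>z. a + b * fst z) z = b"
  using derivatives_of_has_derivative(1)[OF has_derivative_affine_time] by simp

lemma Lie_deriv_add:
  assumes "C1_nbhd S v" "C1_nbhd S w" "z \<in> S"
  shows "Lie_deriv f (\<lambda>z. v z + w z) z = Lie_deriv f v z + Lie_deriv f w z"
proof -
  obtain v' where v': "(v has_derivative blinfun_apply (v' z)) (at z)"
    using C1_nbhdE[OF assms(1)] assms(3) by metis
  obtain w' where w': "(w has_derivative blinfun_apply (w' z)) (at z)"
    using C1_nbhdE[OF assms(2)] assms(3) by metis
  show ?thesis
    by (simp add: derivatives_of_has_derivative(1)[OF has_derivative_add[OF v' w']]
        derivatives_of_has_derivative(1)[OF v'] derivatives_of_has_derivative(1)[OF w'])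
qed

lemma Lie_deriv_scale:
  assumes "C1_nbhd S v" "z \<in> S"
  shows "Lie_deriv f (\<lambda>z. c * v z) z = c * Lie_deriv f v z"
proof -
  obtain v' where v': "(v has_derivative blinfun_apply (v' z)) (at z)"
    using C1_nbhdE[OF assms(1)] assms(2) by metis
  show ?thesis
    by (simp add: derivatives_of_has_derivative(1)[OF has_derivative_mult_right[OF v']]
        derivatives_of_has_derivative(1)[OF v'])
qed

lemma continuous_on_directional:
  assumes v: "C1_nbhd S v"
  shows "continuous_on S f \<Longrightarrow> continuous_on S (Lie_deriv f v)"
    and "continuous_on S f \<Longrightarrow> continuous_on S (\<lambda>z. f z \<bullet> grad_x v z)"
    and "continuous_on S v"
proof -
  obtain v' where v': "\<And>z. z \<in> S \<Longrightarrow> (v has_derivative blinfun_apply (v' z)) (at z)"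
    "continuous_on S v'" "continuous_on S v"
    using v by (rule C1_nbhdE) blast
  show "continuous_on S v" by (rule v'(3))
  assume f: "continuous_on S f"
  have "continuous_on S (\<lambda>z. v' z (1, f z))" "continuous_on S (\<lambda>z. v' z (0, f z))"
    using v'(2) f by (intro continuous_intros; simp)+
  then show "continuous_on S (Lie_deriv f v)" "continuous_on S (\<lambda>z. f z \<bullet> grad_x v z)"
    by (auto simp: derivatives_of_has_derivative[OF v'(1)] cong: continuous_on_cong)
qed

lemma Lie_deriv_rational_field:
  "Lie_deriv (rational_field L f0 N D) v z =
     Lie_deriv f0 v z + (\<Sum>l\<in>{1..L}. (N l z \<bullet> grad_x v z) / D l z)"
  by (simp add: Lie_deriv_def rational_field_def inner_add_left inner_sum_left)

lemma nonneg_measures_onD: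
  assumes "M \<in> nonneg_measures_on S"
  shows "space M = S" and "finite_measure M" and "sets M = sets (restrict_space borel S)"
  using assms sets_eq_imp_space_eq[of M "restrict_space borel S"]
  by (auto simp: nonneg_measures_on_def space_restrict_space)

lemma continuous_measurable_on:
  assumes M: "M \<in> nonneg_measures_on S" and g: "continuous_on S (g :: _ \<Rightarrow> real)"
  shows "g \<in> borel_measurable M"
  using borel_measurable_continuous_on_restrict[OF g] nonneg_measures_onD(3)[OF M]
  by (simp cong: measurable_cong_sets)

lemma continuous_integrable_on:
  assumes K: "compact S" and M: "M \<in> nonneg_measures_on S" and g: "continuous_on S (g :: _ \<Rightarrow> real)"
  shows "integrable M g"
proof -
  interpret finite_measure M using M by (rule nonneg_measures_onD)
  obtain B where B: "\<forall>x\<in>S. \<bar>g x\<bar> \<le> B"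
    using compact_imp_bounded[OF compact_continuous_image[OF g K]] by (auto simp: bounded_iff)
  show ?thesis
    by (rule integrable_const_bound[of _ B])
      (use B nonneg_measures_onD(1)[OF M] continuous_measurable_on[OF M g] in auto)
qed

lemma integral_mono_on:
  assumes K: "compact S" and M: "M \<in> nonneg_measures_on S"
    and g: "continuous_on S (g :: _ \<Rightarrow> real)" and h: "continuous_on S h"
    and le: "\<And>x. x \<in> S \<Longrightarrow> g x \<le> h x"
  shows "(\<integral>x. g x \<partial>M) \<le> (\<integral>x. h x \<partial>M)"
  using le nonneg_measures_onD(1)[OF M]
  by (intro integral_mono continuous_integrable_on[OF K M] g h) auto

section \<open>Weak duality\<close>

text \<open>
  Integrate \<open>p \<le> v\<close> against \<open>\<mu>p\<close>, use the Liouville equation for \<open>v\<close>, and trade \<open>N l \<bullet> grad_x v \<le> D l * q l\<close>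
  under \<open>\<nu> l\<close> for \<open>q l\<close> under \<open>\<mu>\<close>; the terms under \<open>\<mu>\<close> then add up to something nonpositive.
\<close>

lemma weak_duality:
  assumes X: "compact X" and X0: "compact X0" "X0 \<subseteq> X" and T: "0 \<le> T"
    and f0: "continuous_on ({0..T} \<times> X) f0"
    and N: "\<And>l. l \<in> {1..L} \<Longrightarrow> continuous_on ({0..T} \<times> X) (N l)"
    and D: "\<And>l. l \<in> {1..L} \<Longrightarrow> continuous_on ({0..T} \<times> X) (D l)"
    and p: "continuous_on X p"
    and mf: "measure_feasible L f0 N D T X0 X \<mu>0 \<mu> \<mu>p \<nu>"
    and ff: "function_feasible L f0 N D T X0 X p \<gamma> v q"
  shows "(\<integral>(t, x). p x \<partial>\<mu>p) \<le> \<gamma>"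
proof -
  let ?K = "{0..T} \<times> X"
  have K: "compact ?K" using X by (intro compact_Times) auto
  have M: "\<mu>0 \<in> nonneg_measures_on X0" "\<mu> \<in> nonneg_measures_on ?K" "\<mu>p \<in> nonneg_measures_on ?K"
      "\<And>l. l \<in> {1..L} \<Longrightarrow> \<nu> l \<in> nonneg_measures_on ?K" "(\<integral>x. 1 \<partial>\<mu>0) = (1::real)"
    and liouville: "\<And>v. C1_nbhd ?K v \<Longrightarrow> (\<integral>z. v z \<partial>\<mu>p) = (\<integral>x. v (0, x) \<partial>\<mu>0) + (\<integral>z. Lie_deriv f0 v z \<partial>\<mu>)
           + (\<Sum>l\<in>{1..L}. \<integral>z. N l z \<bullet> grad_x v z \<partial>(\<nu> l))"
    and Dnu: "\<And>l \<omega>. l \<in> {1..L} \<Longrightarrow> continuous_on ?K \<omega> \<Longrightarrow> (\<integral>z. \<omega> z * D l z \<partial>(\<nu> l)) = (\<integral>z. \<omega> z \<partial>\<mu>)"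
    using mf unfolding measure_feasible_def by blast+
  have v: "C1_nbhd ?K v" and q: "\<And>l. l \<in> {1..L} \<Longrightarrow> continuous_on ?K (q l)"
    and v0: "\<And>x. x \<in> X0 \<Longrightarrow> v (0, x) \<le> \<gamma>"
    and vp': "\<forall>t\<in>{0..T}. \<forall>x\<in>X. v (t, x) \<ge> p x"
    and Lv': "\<forall>z\<in>?K. - Lie_deriv f0 v z - (\<Sum>l\<in>{1..L}. q l z) \<ge> 0"
    and Dq': "\<forall>l\<in>{1..L}. \<forall>z\<in>?K. D l z * q l z - N l z \<bullet> grad_x v z \<ge> 0"
    using ff unfolding function_feasible_def by blast+
  have vp: "p (snd z) \<le> v z" if "z \<in> ?K" for z
    using vp' that by (cases z) simp
  have Lv: "Lie_deriv f0 v z + (\<Sum>l\<in>{1..L}. q l z) \<le> 0" if "z \<in> ?K" for z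
    using bspec[OF Lv' that] by simp
  have Dq: "N l z \<bullet> grad_x v z \<le> q l z * D l z" if "l \<in> {1..L}" "z \<in> ?K" for l z
    using bspec[OF bspec[OF Dq' that(1)] that(2)] by (simp add: mult.commute)
  note cont = continuous_on_directional[OF v]
  have "(\<integral>(t, x). p x \<partial>\<mu>p) = (\<integral>z. p (snd z) \<partial>\<mu>p)" by (simp add: case_prod_unfold)
  also have "\<dots> \<le> (\<integral>z. v z \<partial>\<mu>p)"
    by (intro integral_mono_on[OF K M(3)] vp cont(3) continuous_on_compose2[OF p]) (auto intro: continuous_intros)
  also have "\<dots> = (\<integral>x. v (0, x) \<partial>\<mu>0) + (\<integral>z. Lie_deriv f0 v z \<partial>\<mu>)
      + (\<Sum>l\<in>{1..L}. \<integral>z. N l z \<bullet> grad_x v z \<partial>(\<nu> l))" by (rule liouville[OF v])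
  also have "(\<integral>x. v (0, x) \<partial>\<mu>0) \<le> (\<integral>x. \<gamma> * 1 \<partial>\<mu>0)"
    using X0(2) T by (intro integral_mono_on[OF X0(1) M(1)] continuous_on_compose2[OF cont(3)] continuous_intros)
      (auto simp: v0)
  also have "\<dots> = \<gamma>" using M(5) by (subst integral_mult_right_zero) simp
  also have "(\<Sum>l\<in>{1..L}. \<integral>z. N l z \<bullet> grad_x v z \<partial>(\<nu> l)) \<le> (\<Sum>l\<in>{1..L}. \<integral>z. q l z \<partial>\<mu>)"
  proof (rule sum_mono)
    fix l assume l: "l \<in> {1..L}"
    have "(\<integral>z. N l z \<bullet> grad_x v z \<partial>(\<nu> l)) \<le> (\<integral>z. q l z * D l z \<partial>(\<nu> l))"
      by (intro integral_mono_on[OF K M(4)[OF l]] cont(2) N D q l Dq continuous_on_mult)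
    then show "(\<integral>z. N l z \<bullet> grad_x v z \<partial>(\<nu> l)) \<le> (\<integral>z. q l z \<partial>\<mu>)"
      using Dnu[OF l q[OF l]] by simp
  qed
  also have "\<gamma> + (\<integral>z. Lie_deriv f0 v z \<partial>\<mu>) + (\<Sum>l\<in>{1..L}. \<integral>z. q l z \<partial>\<mu>)
      = \<gamma> + (\<integral>z. Lie_deriv f0 v z + (\<Sum>l\<in>{1..L}. q l z) \<partial>\<mu>)"
  proof -
    note int = continuous_integrable_on[OF K M(2)]
    have "integrable \<mu> (\<lambda>z. \<Sum>l\<in>{1..L}. q l z)"
      by (intro Bochner_Integration.integrable_sum int q)
    then show ?thesis
      using Bochner_Integration.integral_add[OF int[OF cont(1)[OF f0]]]
        Bochner_Integration.integral_sum[of "{1..L}" \<mu> q, OF int[OF q]] by simp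
  qed
  also have "(\<integral>z. Lie_deriv f0 v z + (\<Sum>l\<in>{1..L}. q l z) \<partial>\<mu>) \<le> (\<integral>z. 0 \<partial>\<mu>)"
    by (intro integral_mono_on[OF K M(2)] continuous_intros cont(1) f0 q Lv)
  finally show ?thesis by simp
qed

section \<open>Functionals on disjoint sums\<close>

lemma bounded_functions_Plus:
  "case_sum a b \<in> bounded_functions (A <+> B) \<longleftrightarrow> a \<in> bounded_functions A \<and> b \<in> bounded_functions B"
  by (simp add: bounded_functions_def Plus_def image_Un image_image)

lemma positive_functional_Plus:
  assumes \<Lambda>: "positive_functional (A <+> B) \<Lambda>"
  shows "positive_functional A (\<lambda>a. \<Lambda> (case_sum a (\<lambda>_. 0)))"
    and "positive_functional B (\<lambda>b. \<Lambda> (case_sum (\<lambda>_. 0) b))"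
    and "a \<in> bounded_functions A \<Longrightarrow> b \<in> bounded_functions B \<Longrightarrow>
      \<Lambda> (case_sum a b) = \<Lambda> (case_sum a (\<lambda>_. 0)) + \<Lambda> (case_sum (\<lambda>_. 0) b)"
proof -
  have lin: "linear_functional_on (bounded_functions (A <+> B)) \<Lambda>"
    and pos: "\<And>F. F \<in> bounded_functions (A <+> B) \<Longrightarrow> (\<And>i. i \<in> A <+> B \<Longrightarrow> F i \<le> 0) \<Longrightarrow> \<Lambda> F \<le> 0"
    using \<Lambda> unfolding positive_functional_def by blast+
  have zero: "(\<lambda>_. 0) \<in> bounded_functions C" for C :: "'z set"
    by (rule function_spaceD(1)[OF function_space_bounded_functions])
  have add: "\<Lambda> (case_sum (\<lambda>x. a x + a' x) (\<lambda>x. b x + b' x)) = \<Lambda> (case_sum a b) + \<Lambda> (case_sum a' b')"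
    if "a \<in> bounded_functions A" "a' \<in> bounded_functions A" "b \<in> bounded_functions B" "b' \<in> bounded_functions B"
    for a a' b b'
  proof -
    have "case_sum (\<lambda>x. a x + a' x) (\<lambda>x. b x + b' x) = (\<lambda>i. case_sum a b i + case_sum a' b' i)"
      by (auto simp: fun_eq_iff split: sum.split)
    then show ?thesis
      using linear_functional_onD(1)[OF lin, of "case_sum a b" "case_sum a' b'"] that
      by (simp add: bounded_functions_Plus)
  qed
  have scale: "\<Lambda> (case_sum (\<lambda>x. c * a x) (\<lambda>x. c * b x)) = c * \<Lambda> (case_sum a b)"
    if "a \<in> bounded_functions A" "b \<in> bounded_functions B" for a b c
  proof -
    have "case_sum (\<lambda>x. c * a x) (\<lambda>x. c * b x) = (\<lambda>i. c * case_sum a b i)"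
      by (auto simp: fun_eq_iff split: sum.split)
    then show ?thesis
      using linear_functional_onD(2)[OF lin, of "case_sum a b" c] that
      by (simp add: bounded_functions_Plus)
  qed
  show "positive_functional A (\<lambda>a. \<Lambda> (case_sum a (\<lambda>_. 0)))"
    unfolding positive_functional_def linear_functional_on_def
  proof (intro conjI ballI allI impI)
    fix a a' assume "a \<in> bounded_functions A" "a' \<in> bounded_functions A"
    then show "\<Lambda> (case_sum (\<lambda>i. a i + a' i) (\<lambda>_. 0)) = \<Lambda> (case_sum a (\<lambda>_. 0)) + \<Lambda> (case_sum a' (\<lambda>_. 0))"
      using add[OF _ _ zero zero] by simp
  next
    fix a and c :: real assume "a \<in> bounded_functions A"
    then show "\<Lambda> (case_sum (\<lambda>i. c * a i) (\<lambda>_. 0)) = c * \<Lambda> (case_sum a (\<lambda>_. 0))"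
      using scale[OF _ zero] by simp
  next
    fix a :: "'a \<Rightarrow> real" assume "a \<in> bounded_functions A" "\<forall>x\<in>A. a x \<le> 0"
    then show "\<Lambda> (case_sum a (\<lambda>_. 0)) \<le> 0"
      by (intro pos) (auto simp: bounded_functions_Plus zero)
  qed
  show "positive_functional B (\<lambda>b. \<Lambda> (case_sum (\<lambda>_. 0) b))"
    unfolding positive_functional_def linear_functional_on_def
  proof (intro conjI ballI allI impI)
    fix b b' assume "b \<in> bounded_functions B" "b' \<in> bounded_functions B"
    then show "\<Lambda> (case_sum (\<lambda>_. 0) (\<lambda>i. b i + b' i)) = \<Lambda> (case_sum (\<lambda>_. 0) b) + \<Lambda> (case_sum (\<lambda>_. 0) b')"
      using add[OF zero zero] by simp
  next
    fix b and c :: real assume "b \<in> bounded_functions B"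
    then show "\<Lambda> (case_sum (\<lambda>_. 0) (\<lambda>i. c * b i)) = c * \<Lambda> (case_sum (\<lambda>_. 0) b)"
      using scale[OF zero] by simp
  next
    fix b :: "'b \<Rightarrow> real" assume "b \<in> bounded_functions B" "\<forall>x\<in>B. b x \<le> 0"
    then show "\<Lambda> (case_sum (\<lambda>_. 0) b) \<le> 0"
      by (intro pos) (auto simp: bounded_functions_Plus zero)
  qed
  show "\<Lambda> (case_sum a b) = \<Lambda> (case_sum a (\<lambda>_. 0)) + \<Lambda> (case_sum (\<lambda>_. 0) b)"
    if "a \<in> bounded_functions A" "b \<in> bounded_functions B"
    using add[OF that(1) zero zero that(2)] by simp
qed

section \<open>The Liouville program attains its dual bound\<close>

text \<open>
  The function on the sum type collects the perturbations of the three inequalities of the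
  function program: on \<open>X0\<close>, for \<open>v \<ge> p\<close>, and for \<open>L\<^sub>f v \<le> 0\<close>. The multiplier \<open>r \<ge> 0\<close> of \<open>p\<close> homogenises
  the program; it makes the infimum sublinear and allows \<open>p\<close> itself as a perturbation, which
  \<open>v = 0\<close>, \<open>r = 1\<close> balances against \<open>d\<close>.
\<close>

definition perturbed_bounds ::
  "real \<Rightarrow> (real^'n) set \<Rightarrow> (real^'n) set \<Rightarrow> (real \<times> (real^'n) \<Rightarrow> real^'n) \<Rightarrow> (real^'n \<Rightarrow> real) \<Rightarrow> real \<Rightarrow>
   ((real^'n) + (real \<times> (real^'n)) + (real \<times> (real^'n)) \<Rightarrow> real) \<Rightarrow> real set" where
  "perturbed_bounds T X0 X f p d F = {\<gamma>. \<exists>v r. C1_nbhd ({0..T} \<times> X) v \<and> 0 \<le> r \<and>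
     (\<forall>x\<in>X0. F (Inl x) + v (0, x) \<le> \<gamma> + r * d) \<and>
     (\<forall>z\<in>{0..T} \<times> X. F (Inr (Inl z)) + r * p (snd z) \<le> v z) \<and>
     (\<forall>z\<in>{0..T} \<times> X. F (Inr (Inr z)) \<le> - Lie_deriv f v z)}"

lemma perturbed_boundsI:
  assumes "C1_nbhd ({0..T} \<times> X) v" "0 \<le> r" "\<And>x. x \<in> X0 \<Longrightarrow> F (Inl x) + v (0, x) \<le> \<gamma> + r * d"
    "\<And>z. z \<in> {0..T} \<times> X \<Longrightarrow> F (Inr (Inl z)) + r * p (snd z) \<le> v z"
    "\<And>z. z \<in> {0..T} \<times> X \<Longrightarrow> F (Inr (Inr z)) \<le> - Lie_deriv f v z"
  shows "\<gamma> \<in> perturbed_bounds T X0 X f p d F"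
  using assms unfolding perturbed_bounds_def by blast

lemma perturbed_boundsE:
  assumes "\<gamma> \<in> perturbed_bounds T X0 X f p d F"
  obtains v r where "C1_nbhd ({0..T} \<times> X) v" "0 \<le> r"
    "\<And>x. x \<in> X0 \<Longrightarrow> F (Inl x) + v (0, x) \<le> \<gamma> + r * d"
    "\<And>z. z \<in> {0..T} \<times> X \<Longrightarrow> F (Inr (Inl z)) + r * p (snd z) \<le> v z"
    "\<And>z. z \<in> {0..T} \<times> X \<Longrightarrow> F (Inr (Inr z)) \<le> - Lie_deriv f v z"
  using assms unfolding perturbed_bounds_def by blast

lemma perturbed_bounds_add:
  assumes "\<gamma> \<in> perturbed_bounds T X0 X f p d F" "\<eta> \<in> perturbed_bounds T X0 X f p d G"
  shows "\<gamma> + \<eta> \<in> perturbed_bounds T X0 X f p d (\<lambda>i. F i + G i)"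
proof -
  let ?K = "{0..T} \<times> X"
  obtain v r where v: "C1_nbhd ?K v" "0 \<le> r" "\<And>x. x \<in> X0 \<Longrightarrow> F (Inl x) + v (0, x) \<le> \<gamma> + r * d"
    "\<And>z. z \<in> ?K \<Longrightarrow> F (Inr (Inl z)) + r * p (snd z) \<le> v z"
    "\<And>z. z \<in> ?K \<Longrightarrow> F (Inr (Inr z)) \<le> - Lie_deriv f v z"
    using assms(1) by (rule perturbed_boundsE) blast
  obtain w s where w: "C1_nbhd ?K w" "0 \<le> s" "\<And>x. x \<in> X0 \<Longrightarrow> G (Inl x) + w (0, x) \<le> \<eta> + s * d"
    "\<And>z. z \<in> ?K \<Longrightarrow> G (Inr (Inl z)) + s * p (snd z) \<le> w z"
    "\<And>z. z \<in> ?K \<Longrightarrow> G (Inr (Inr z)) \<le> - Lie_deriv f w z"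
    using assms(2) by (rule perturbed_boundsE) blast
  show ?thesis
  proof (rule perturbed_boundsI[where v = "\<lambda>z. v z + w z" and r = "r + s"])
    show "C1_nbhd ?K (\<lambda>z. v z + w z)" by (rule C1_nbhd_add[OF v(1) w(1)])
    show "0 \<le> r + s" using v(2) w(2) by simp
    show "F (Inl x) + G (Inl x) + (v (0, x) + w (0, x)) \<le> \<gamma> + \<eta> + (r + s) * d" if "x \<in> X0" for x
      using v(3)[OF that] w(3)[OF that] by (simp add: algebra_simps)
    fix z assume z: "z \<in> ?K"
    show "F (Inr (Inl z)) + G (Inr (Inl z)) + (r + s) * p (snd z) \<le> v z + w z"
      using v(4)[OF z] w(4)[OF z] by (simp add: algebra_simps)
    show "F (Inr (Inr z)) + G (Inr (Inr z)) \<le> - Lie_deriv f (\<lambda>z. v z + w z) z"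
      using v(5)[OF z] w(5)[OF z] Lie_deriv_add[OF v(1) w(1) z] by simp
  qed
qed

lemma perturbed_bounds_scale:
  assumes "\<gamma> \<in> perturbed_bounds T X0 X f p d F" and c: "c > 0"
  shows "c * \<gamma> \<in> perturbed_bounds T X0 X f p d (\<lambda>i. c * F i)"
proof -
  let ?K = "{0..T} \<times> X"
  obtain v r where v: "C1_nbhd ?K v" "0 \<le> r" "\<And>x. x \<in> X0 \<Longrightarrow> F (Inl x) + v (0, x) \<le> \<gamma> + r * d"
    "\<And>z. z \<in> ?K \<Longrightarrow> F (Inr (Inl z)) + r * p (snd z) \<le> v z"
    "\<And>z. z \<in> ?K \<Longrightarrow> F (Inr (Inr z)) \<le> - Lie_deriv f v z"
    using assms(1) by (rule perturbed_boundsE) blast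
  show ?thesis
  proof (rule perturbed_boundsI[where v = "\<lambda>z. c * v z" and r = "c * r"])
    show "C1_nbhd ?K (\<lambda>z. c * v z)" by (rule C1_nbhd_scale[OF v(1)])
    show "0 \<le> c * r" using v(2) c by simp
    show "c * F (Inl x) + c * v (0, x) \<le> c * \<gamma> + c * r * d" if "x \<in> X0" for x
      using mult_left_mono[OF v(3)[OF that], of c] c by (simp add: algebra_simps)
    fix z assume z: "z \<in> ?K"
    show "c * F (Inr (Inl z)) + c * r * p (snd z) \<le> c * v z"
      using mult_left_mono[OF v(4)[OF z], of c] c by (simp add: algebra_simps)
    show "c * F (Inr (Inr z)) \<le> - Lie_deriv f (\<lambda>z. c * v z) z"
      using mult_left_mono[OF v(5)[OF z], of c] c Lie_deriv_scale[OF v(1) z] by simp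
  qed
qed

text \<open>
  This is where the hypothesis on \<open>d\<close> is used: for \<open>r > 0\<close> dividing by \<open>r\<close> gives a feasible point of the
  unperturbed program. For \<open>r = 0\<close> the inequality \<open>v \<ge> 0\<close> at one initial point suffices.
\<close>

lemma perturbed_bounds_zero_nonneg:
  assumes T: "0 \<le> T" and X0: "X0 \<subseteq> X" "X0 \<noteq> {}"
    and d: "\<And>\<gamma> v. C1_nbhd ({0..T} \<times> X) v \<Longrightarrow> \<forall>x\<in>X0. v (0, x) \<le> \<gamma> \<Longrightarrow>
      \<forall>z\<in>{0..T} \<times> X. p (snd z) \<le> v z \<Longrightarrow> \<forall>z\<in>{0..T} \<times> X. Lie_deriv f v z \<le> 0 \<Longrightarrow> d \<le> \<gamma>"
    and \<gamma>: "\<gamma> \<in> perturbed_bounds T X0 X f p d (\<lambda>_. 0)"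
  shows "0 \<le> \<gamma>"
proof -
  let ?K = "{0..T} \<times> X"
  obtain v r where v: "C1_nbhd ?K v" "0 \<le> r" "\<And>x. x \<in> X0 \<Longrightarrow> 0 + v (0, x) \<le> \<gamma> + r * d"
    "\<And>z. z \<in> ?K \<Longrightarrow> 0 + r * p (snd z) \<le> v z" "\<And>z. z \<in> ?K \<Longrightarrow> 0 \<le> - Lie_deriv f v z"
    using \<gamma> by (rule perturbed_boundsE) blast
  show ?thesis
  proof (cases "r = 0")
    case True
    obtain x where "x \<in> X0" using X0(2) by blast
    then show ?thesis using v(3)[of x] v(4)[of "(0, x)"] X0(1) T True by force
  next
    case False
    then have r: "r > 0" using v(2) by simp
    have "d \<le> (1 / r) * (\<gamma> + r * d)"
    proof (rule d[of "\<lambda>z. (1 / r) * v z"])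
      show "C1_nbhd ?K (\<lambda>z. (1 / r) * v z)" by (rule C1_nbhd_scale[OF v(1)])
      show "\<forall>x\<in>X0. (1 / r) * v (0, x) \<le> (1 / r) * (\<gamma> + r * d)"
        using v(3) r by (auto intro!: divide_right_mono)
      show "\<forall>z\<in>?K. p (snd z) \<le> (1 / r) * v z"
        using v(4) r by (simp add: field_simps)
      show "\<forall>z\<in>?K. Lie_deriv f (\<lambda>z. (1 / r) * v z) z \<le> 0"
      proof
        fix z assume z: "z \<in> ?K"
        then show "Lie_deriv f (\<lambda>z. (1 / r) * v z) z \<le> 0"
          unfolding Lie_deriv_scale[OF v(1) z] using v(5)[OF z] r by (simp add: divide_le_0_iff)
      qed
    qed
    then show ?thesis using r by (simp add: field_simps)
  qed
qed

text \<open>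
  The function \<open>u = B + B * (T - t)\<close> satisfies \<open>u \<ge> B\<close> and \<open>L\<^sub>f u = - B\<close>, so it absorbs any perturbation of
  size \<open>B\<close> at the price of raising \<open>\<gamma>\<close> by a constant. This shows feasibility, and it bounds \<open>\<gamma>\<close> from below
  by reduction to the zero perturbation.
\<close>

lemma perturbed_bounds_bounded:
  fixes X X0 :: "(real^'n) set"
  assumes T: "0 \<le> T" and X0: "X0 \<subseteq> X" "X0 \<noteq> {}"
    and d: "\<And>\<gamma> v. C1_nbhd ({0..T} \<times> X) v \<Longrightarrow> \<forall>x\<in>X0. v (0, x) \<le> \<gamma> \<Longrightarrow>
      \<forall>z\<in>{0..T} \<times> X. p (snd z) \<le> v z \<Longrightarrow> \<forall>z\<in>{0..T} \<times> X. Lie_deriv f v z \<le> 0 \<Longrightarrow> d \<le> \<gamma>"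
    and F: "F \<in> bounded_functions (X0 <+> ({0..T} \<times> X) <+> ({0..T} \<times> X))"
  shows "perturbed_bounds T X0 X f p d F \<noteq> {}" and "bdd_below (perturbed_bounds T X0 X f p d F)"
proof -
  let ?K = "{0..T} \<times> X"
  obtain B' where B': "\<And>i. i \<in> X0 <+> ?K <+> ?K \<Longrightarrow> \<bar>F i\<bar> \<le> B'"
    using F by (auto simp: bounded_functions_def bounded_iff)
  define B where "B = max B' 0"
  have B: "0 \<le> B" "\<And>i. i \<in> X0 <+> ?K <+> ?K \<Longrightarrow> \<bar>F i\<bar> \<le> B"
    using B' by (fastforce simp: B_def)+
  have FB: "\<bar>F (Inl x)\<bar> \<le> B" if "x \<in> X0" for x
    using that by (intro B(2)) auto
  have FK: "\<bar>F (Inr (Inl z))\<bar> \<le> B" "\<bar>F (Inr (Inr z))\<bar> \<le> B" if "z \<in> ?K" for z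
    using that by (auto intro!: B(2))
  define u :: "real \<times> (real^'n) \<Rightarrow> real" where "u z = (B + B * T) + (- B) * fst z" for z
  have u: "C1_nbhd ?K u" "\<And>z. Lie_deriv f u z = - B" "\<And>x. u (0, x) = B + B * T"
    unfolding u_def by (rule C1_nbhd_affine_time, rule Lie_deriv_affine_time, simp)
  have uB: "B \<le> u z" if "z \<in> ?K" for z
    using that mult_left_mono[of "fst z" T B] B(1) by (auto simp: u_def)
  have "2 * B + B * T \<in> perturbed_bounds T X0 X f p d F"
    by (rule perturbed_boundsI[where v = u and r = 0])
      (use u FB FK uB in \<open>fastforce simp: abs_le_iff intro: order_trans\<close>)+
  then show "perturbed_bounds T X0 X f p d F \<noteq> {}" by blast
  show "bdd_below (perturbed_bounds T X0 X f p d F)"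
  proof (rule bdd_belowI)
    fix \<gamma> assume "\<gamma> \<in> perturbed_bounds T X0 X f p d F"
    then obtain v r where v: "C1_nbhd ?K v" "0 \<le> r" "\<And>x. x \<in> X0 \<Longrightarrow> F (Inl x) + v (0, x) \<le> \<gamma> + r * d"
      "\<And>z. z \<in> ?K \<Longrightarrow> F (Inr (Inl z)) + r * p (snd z) \<le> v z"
      "\<And>z. z \<in> ?K \<Longrightarrow> F (Inr (Inr z)) \<le> - Lie_deriv f v z"
      by (rule perturbed_boundsE) blast
    have "\<gamma> + (2 * B + B * T) \<in> perturbed_bounds T X0 X f p d (\<lambda>_. 0)"
    proof (rule perturbed_boundsI[where v = "\<lambda>z. v z + u z" and r = r])
      show "C1_nbhd ?K (\<lambda>z. v z + u z)" by (rule C1_nbhd_add[OF v(1) u(1)])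
      show "0 \<le> r" by (rule v(2))
      show "0 + (v (0, x) + u (0, x)) \<le> \<gamma> + (2 * B + B * T) + r * d" if "x \<in> X0" for x
        using v(3)[OF that] FB[OF that] u(3)[of x] by simp
      fix z assume z: "z \<in> ?K"
      show "0 + r * p (snd z) \<le> v z + u z"
        using v(4)[OF z] FK(1)[OF z] uB[OF z] by simp
      show "0 \<le> - Lie_deriv f (\<lambda>z. v z + u z) z"
        using v(5)[OF z] FK(2)[OF z] u(2)[of z] Lie_deriv_add[OF v(1) u(1) z] by simp
    qed
    then have "0 \<le> \<gamma> + (2 * B + B * T)"
      by (rule perturbed_bounds_zero_nonneg[OF T X0, rotated]) (rule d)
    then show "- (2 * B + B * T) \<le> \<gamma>" by simp
  qed
qed

text \<open>
  If \<open>d\<close> is a lower bound of the function program for the vector field \<open>f\<close>, the measure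
  program has a feasible point of value at least \<open>d\<close>. The measures represent the three components of
  a linear functional \<open>\<Lambda>\<close> below \<open>P F = inf (perturbed_bounds \<dots> F)\<close>; every property of
  them is read off from one explicit element of \<open>perturbed_bounds\<close>.
\<close>

theorem liouville_measures_attain:
  fixes X X0 :: "(real^'n) set"
  assumes T: "0 \<le> T" and X: "compact X" and X0: "compact X0" "X0 \<subseteq> X" "X0 \<noteq> {}"
    and p: "continuous_on X p" and f: "continuous_on ({0..T} \<times> X) f"
    and d: "\<And>\<gamma> v. C1_nbhd ({0..T} \<times> X) v \<Longrightarrow> \<forall>x\<in>X0. v (0, x) \<le> \<gamma> \<Longrightarrow>
      \<forall>z\<in>{0..T} \<times> X. p (snd z) \<le> v z \<Longrightarrow> \<forall>z\<in>{0..T} \<times> X. Lie_deriv f v z \<le> 0 \<Longrightarrow> d \<le> \<gamma>"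
  obtains \<mu>0 \<mu> \<mu>p where "\<mu>0 \<in> nonneg_measures_on X0" "\<mu> \<in> nonneg_measures_on ({0..T} \<times> X)"
    "\<mu>p \<in> nonneg_measures_on ({0..T} \<times> X)"
    "\<And>v. C1_nbhd ({0..T} \<times> X) v \<Longrightarrow>
      (\<integral>z. v z \<partial>\<mu>p) = (\<integral>x. v (0, x) \<partial>\<mu>0) + (\<integral>z. Lie_deriv f v z \<partial>\<mu>)"
    "(\<integral>x. 1 \<partial>\<mu>0) = (1::real)" "d \<le> (\<integral>z. p (snd z) \<partial>\<mu>p)"
proof -
  let ?K = "{0..T} \<times> X"
  let ?S = "X0 <+> ?K <+> ?K"
  let ?V = "bounded_functions ?S"
  let ?\<Gamma> = "perturbed_bounds T X0 X f p d"
  define P where "P F = Inf (?\<Gamma> F)" for F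
  note V = function_spaceD[OF function_space_bounded_functions[of ?S]]
  note bdd = perturbed_bounds_bounded[OF T X0(2,3) d]
  have P_le: "P F \<le> \<gamma>" if "F \<in> ?V" "\<gamma> \<in> ?\<Gamma> F" for F \<gamma>
    unfolding P_def using bdd(2)[OF _ _ _ _ that(1)] that(2) by (intro cInf_lower) auto
  have le_P: "y \<le> P F" if "F \<in> ?V" "\<And>\<gamma>. \<gamma> \<in> ?\<Gamma> F \<Longrightarrow> y \<le> \<gamma>" for F y
    unfolding P_def using bdd(1)[OF _ _ _ _ that(1)] that(2) by (intro cInf_greatest) auto
  have "sublinear_on ?V P"
    unfolding sublinear_on_def
  proof (intro conjI ballI allI impI)
    fix F G assume F: "F \<in> ?V" and G: "G \<in> ?V"
    have sum: "P (\<lambda>i. F i + G i) \<le> \<gamma> + \<eta>" if "\<gamma> \<in> ?\<Gamma> F" "\<eta> \<in> ?\<Gamma> G" for \<gamma> \<eta>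
      by (rule P_le[OF V(2)[OF F G] perturbed_bounds_add[OF that]])
    have "P (\<lambda>i. F i + G i) - \<gamma> \<le> P G" if "\<gamma> \<in> ?\<Gamma> F" for \<gamma>
      using sum[OF that] by (intro le_P G) (simp add: algebra_simps)
    then have "P (\<lambda>i. F i + G i) - P G \<le> P F"
      by (intro le_P F) (simp add: algebra_simps)
    then show "P (\<lambda>i. F i + G i) \<le> P F + P G" by simp
  next
    fix F and c :: real assume F: "F \<in> ?V" and c: "c > 0"
    have "P (\<lambda>i. c * F i) / c \<le> P F"
    proof (rule le_P[OF F])
      fix \<gamma> assume "\<gamma> \<in> ?\<Gamma> F"
      then show "P (\<lambda>i. c * F i) / c \<le> \<gamma>"
        using P_le[OF V(3)[OF F] perturbed_bounds_scale[OF _ c]] c by (simp add: field_simps)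
    qed
    then show "P (\<lambda>i. c * F i) \<le> c * P F"
      using c by (simp add: field_simps)
  qed
  then obtain \<Lambda> where lin: "linear_functional_on ?V \<Lambda>" and dom: "\<And>F. F \<in> ?V \<Longrightarrow> \<Lambda> F \<le> P F"
    using sublinear_dominates_linear[OF function_space_bounded_functions] by blast
  have \<Lambda>_le: "\<Lambda> F \<le> \<gamma>" if "F \<in> ?V" "\<gamma> \<in> ?\<Gamma> F" for F \<gamma>
    using dom[OF that(1)] P_le[OF that] by simp
  have zero: "C1_nbhd ?K (\<lambda>_. 0)" "\<And>z. Lie_deriv f (\<lambda>_. 0) z = 0"
    using C1_nbhd_affine_time[of ?K 0 0] Lie_deriv_affine_time[of f 0 0] by simp_all
  have pos: "positive_functional ?S \<Lambda>"
    unfolding positive_functional_def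
  proof (intro conjI ballI impI)
    fix F assume F: "F \<in> ?V" "\<forall>i\<in>?S. F i \<le> 0"
    have "0 \<in> ?\<Gamma> F"
      by (rule perturbed_boundsI[where v = "\<lambda>_. 0" and r = 0]) (use zero F(2) in auto)
    then show "\<Lambda> F \<le> 0" by (rule \<Lambda>_le[OF F(1)])
  qed (rule lin)
  define \<Lambda>0 where "\<Lambda>0 a = \<Lambda> (case_sum a (\<lambda>_. 0))" for a
  define \<Lambda>p where "\<Lambda>p b = \<Lambda> (case_sum (\<lambda>_. 0) (case_sum b (\<lambda>_. 0)))" for b
  define \<Lambda>\<mu> where "\<Lambda>\<mu> c = \<Lambda> (case_sum (\<lambda>_. 0) (case_sum (\<lambda>_. 0) c))" for c
  note split1 = positive_functional_Plus[OF pos]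
  note split2 = positive_functional_Plus[OF split1(2)]
  have pos': "positive_functional X0 \<Lambda>0" "positive_functional ?K \<Lambda>p" "positive_functional ?K \<Lambda>\<mu>"
    unfolding \<Lambda>0_def \<Lambda>p_def \<Lambda>\<mu>_def by (rule split1(1) split2(1) split2(2))+
  have K: "compact ?K" "?K \<noteq> {}"
    using X X0 T by (auto intro: compact_Times)
  obtain \<mu>0 where \<mu>0: "\<mu>0 \<in> nonneg_measures_on X0"
    "\<And>g. continuous_on X0 g \<Longrightarrow> (\<integral>x. g x \<partial>\<mu>0) = \<Lambda>0 g"
    using riesz_representation[OF X0(1,3) pos'(1)] by blast
  obtain \<mu>p where \<mu>p: "\<mu>p \<in> nonneg_measures_on ?K"
    "\<And>g. continuous_on ?K g \<Longrightarrow> (\<integral>z. g z \<partial>\<mu>p) = \<Lambda>p g"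
    using riesz_representation[OF K pos'(2)] by blast
  obtain \<mu> where \<mu>: "\<mu> \<in> nonneg_measures_on ?K"
    "\<And>g. continuous_on ?K g \<Longrightarrow> (\<integral>z. g z \<partial>\<mu>) = \<Lambda>\<mu> g"
    using riesz_representation[OF K pos'(3)] by blast
  have key: "(\<integral>x. a x \<partial>\<mu>0) + (\<integral>z. b z \<partial>\<mu>p) + (\<integral>z. c z \<partial>\<mu>) \<le> \<gamma>"
    if cont: "continuous_on X0 a" "continuous_on ?K b" "continuous_on ?K c"
      and \<gamma>: "\<gamma> \<in> ?\<Gamma> (case_sum a (case_sum b c))" for a b c \<gamma>
  proof -
    note B = continuous_in_bounded_functions[OF X0(1) cont(1)]
      continuous_in_bounded_functions[OF K(1) cont(2)] continuous_in_bounded_functions[OF K(1) cont(3)]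
    have "case_sum b c \<in> bounded_functions (?K <+> ?K)"
      using B by (simp add: bounded_functions_Plus)
    then have "\<Lambda> (case_sum a (case_sum b c)) = \<Lambda>0 a + (\<Lambda>p b + \<Lambda>\<mu> c)"
      unfolding \<Lambda>0_def \<Lambda>p_def \<Lambda>\<mu>_def using split1(3)[OF B(1)] split2(3)[OF B(2,3)] by simp
    moreover have "\<Lambda> (case_sum a (case_sum b c)) \<le> \<gamma>"
      using B \<gamma> by (intro \<Lambda>_le) (simp_all add: bounded_functions_Plus)
    ultimately show ?thesis
      using \<mu>0(2)[OF cont(1)] \<mu>p(2)[OF cont(2)] \<mu>(2)[OF cont(3)] by simp
  qed
  \<comment> \<open>The perturbation \<open>(- v (0, \<cdot>), v, - L\<^sub>f v)\<close> is compensated by \<open>v\<close> itself, at no cost.\<close>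
  have half: "(\<integral>z. v z \<partial>\<mu>p) \<le> (\<integral>x. v (0, x) \<partial>\<mu>0) + (\<integral>z. Lie_deriv f v z \<partial>\<mu>)"
    if v: "C1_nbhd ?K v" for v
  proof -
    note cont = continuous_on_directional[OF v]
    have "(\<integral>x. - v (0, x) \<partial>\<mu>0) + (\<integral>z. v z \<partial>\<mu>p) + (\<integral>z. - Lie_deriv f v z \<partial>\<mu>) \<le> 0"
    proof (rule key)
      show "continuous_on X0 (\<lambda>x. - v (0, x))"
        using X0(2) T by (intro continuous_intros continuous_on_compose2[OF cont(3)]) auto
      show "continuous_on ?K v" by (rule cont(3))
      show "continuous_on ?K (\<lambda>z. - Lie_deriv f v z)" by (intro continuous_intros cont(1) f)
      show "0 \<in> ?\<Gamma> (case_sum (\<lambda>x. - v (0, x)) (case_sum v (\<lambda>z. - Lie_deriv f v z)))"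
        by (rule perturbed_boundsI[where v = v and r = 0]) (use v in auto)
    qed
    then show ?thesis by simp
  qed
  have liouville: "(\<integral>z. v z \<partial>\<mu>p) = (\<integral>x. v (0, x) \<partial>\<mu>0) + (\<integral>z. Lie_deriv f v z \<partial>\<mu>)"
    if v: "C1_nbhd ?K v" for v
  proof (rule antisym)
    have "(\<integral>z. (-1) * v z \<partial>\<mu>p) \<le> (\<integral>x. (-1) * v (0, x) \<partial>\<mu>0) + (\<integral>z. Lie_deriv f (\<lambda>z. (-1) * v z) z \<partial>\<mu>)"
      by (rule half[OF C1_nbhd_scale[OF v]])
    also have "(\<integral>z. Lie_deriv f (\<lambda>z. (-1) * v z) z \<partial>\<mu>) = (\<integral>z. (-1) * Lie_deriv f v z \<partial>\<mu>)"
      by (rule Bochner_Integration.integral_cong[OF refl Lie_deriv_scale[OF v]])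
        (simp add: nonneg_measures_onD(1)[OF \<mu>(1)])
    finally show "(\<integral>x. v (0, x) \<partial>\<mu>0) + (\<integral>z. Lie_deriv f v z \<partial>\<mu>) \<le> (\<integral>z. v z \<partial>\<mu>p)" by simp
  qed (rule half[OF v])
  have const: "c * (\<integral>x. 1 \<partial>\<mu>0) \<le> c" for c :: real
  proof -
    have "(\<integral>x. c \<partial>\<mu>0) + (\<integral>z. 0 \<partial>\<mu>p) + (\<integral>z. 0 \<partial>\<mu>) \<le> c"
    proof (rule key)
      show "c \<in> ?\<Gamma> (case_sum (\<lambda>_. c) (case_sum (\<lambda>_. 0) (\<lambda>_. 0)))"
        by (rule perturbed_boundsI[where v = "\<lambda>_. 0" and r = 0]) (use zero in auto)
    qed auto
    then show ?thesis by (simp add: mult.commute)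
  qed
  have mass: "(\<integral>x. 1 \<partial>\<mu>0) = (1::real)"
    using const[of 1] const[of "-1"] by simp
  have p': "continuous_on ?K (\<lambda>z. p (snd z))"
    by (intro continuous_on_compose2[OF p]) (auto intro: continuous_intros)
  have "(\<integral>x. d \<partial>\<mu>0) + (\<integral>z. - p (snd z) \<partial>\<mu>p) + (\<integral>z. 0 \<partial>\<mu>) \<le> 0"
  proof (rule key)
    show "0 \<in> ?\<Gamma> (case_sum (\<lambda>_. d) (case_sum (\<lambda>z. - p (snd z)) (\<lambda>_. 0)))"
      by (rule perturbed_boundsI[where v = "\<lambda>_. 0" and r = 1]) (use zero in auto)
  qed (auto intro: continuous_intros p')
  then have "d \<le> (\<integral>z. p (snd z) \<partial>\<mu>p)"
    using integral_mult_right_zero[of \<mu>0 d "\<lambda>_. 1"] mass by simp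
  then show thesis
    using that[OF \<mu>0(1) \<mu>(1) \<mu>p(1) liouville mass] by blast
qed

section \<open>Strong duality\<close>

lemma density_in_nonneg_measures_on:
  assumes S: "compact S" and M: "M \<in> nonneg_measures_on S"
    and g: "continuous_on S (g :: _ \<Rightarrow> real)" "\<And>z. z \<in> S \<Longrightarrow> 0 \<le> g z"
  shows "density M (\<lambda>z. ennreal (g z)) \<in> nonneg_measures_on S"
    and "continuous_on S (h :: _ \<Rightarrow> real) \<Longrightarrow> (\<integral>z. h z \<partial>density M (\<lambda>z. ennreal (g z))) = (\<integral>z. g z * h z \<partial>M)"
proof -
  have AE: "AE z in M. 0 \<le> g z"
    using g(2) nonneg_measures_onD(1)[OF M] by (intro AE_I2) auto
  have meas [measurable]: "g \<in> borel_measurable M" by (rule continuous_measurable_on[OF M g(1)])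
  have "emeasure (density M (\<lambda>z. ennreal (g z))) (space M) = (\<integral>\<^sup>+z. ennreal (g z) \<partial>M)"
    by (subst emeasure_density) (auto intro!: nn_integral_cong)
  also have "\<dots> = ennreal (\<integral>z. g z \<partial>M)"
    by (rule nn_integral_eq_integral[OF continuous_integrable_on[OF S M g(1)] AE])
  finally have "finite_measure (density M (\<lambda>z. ennreal (g z)))"
    by (intro finite_measureI) simp
  then show "density M (\<lambda>z. ennreal (g z)) \<in> nonneg_measures_on S"
    using nonneg_measures_onD(3)[OF M] by (simp add: nonneg_measures_on_def)
  show "(\<integral>z. h z \<partial>density M (\<lambda>z. ennreal (g z))) = (\<integral>z. g z * h z \<partial>M)" if h: "continuous_on S h"
    using integral_density[OF continuous_measurable_on[OF M h] meas AE] by simp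
qed

text \<open>
  On continuous test functions the choice \<open>\<nu> l = \<mu> / D l\<close> turns the sum of the \<open>\<nu> l\<close>-terms into the
  rational part of \<open>L\<^sub>f v\<close> under \<open>\<mu>\<close>.
\<close>

lemma measure_feasible_of_liouville:
  assumes X: "compact X"
    and f0: "continuous_on ({0..T} \<times> X) f0"
    and N: "\<And>l. l \<in> {1..L} \<Longrightarrow> continuous_on ({0..T} \<times> X) (N l)"
    and D: "\<And>l. l \<in> {1..L} \<Longrightarrow> continuous_on ({0..T} \<times> X) (D l)"
    and D_pos: "\<And>l z. l \<in> {1..L} \<Longrightarrow> z \<in> {0..T} \<times> X \<Longrightarrow> D l z > 0"
    and M: "\<mu>0 \<in> nonneg_measures_on X0" "\<mu> \<in> nonneg_measures_on ({0..T} \<times> X)"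
      "\<mu>p \<in> nonneg_measures_on ({0..T} \<times> X)" "(\<integral>x. 1 \<partial>\<mu>0) = (1::real)"
    and liouville: "\<And>v. C1_nbhd ({0..T} \<times> X) v \<Longrightarrow>
      (\<integral>z. v z \<partial>\<mu>p) = (\<integral>x. v (0, x) \<partial>\<mu>0) + (\<integral>z. Lie_deriv (rational_field L f0 N D) v z \<partial>\<mu>)"
  shows "measure_feasible L f0 N D T X0 X \<mu>0 \<mu> \<mu>p (\<lambda>l. density \<mu> (\<lambda>z. ennreal (1 / D l z)))"
proof -
  let ?K = "{0..T} \<times> X"
  let ?\<nu> = "\<lambda>l. density \<mu> (\<lambda>z. ennreal (1 / D l z))"
  have K: "compact ?K" using X by (intro compact_Times) auto
  have sp: "space \<mu> = ?K" by (rule nonneg_measures_onD(1)[OF M(2)])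
  have inv: "continuous_on ?K (\<lambda>z. 1 / D l z)" "\<And>z. z \<in> ?K \<Longrightarrow> 0 \<le> 1 / D l z" if l: "l \<in> {1..L}" for l
  proof -
    have "\<forall>z\<in>?K. D l z \<noteq> 0" using D_pos[OF l] by (metis less_irrefl)
    then show "continuous_on ?K (\<lambda>z. 1 / D l z)" by (intro continuous_on_divide continuous_on_const D l)
    show "0 \<le> 1 / D l z" if "z \<in> ?K" for z using D_pos[OF l that] by simp
  qed
  have dens: "?\<nu> l \<in> nonneg_measures_on ?K"
      "\<And>h. continuous_on ?K h \<Longrightarrow> (\<integral>z. h z \<partial>?\<nu> l) = (\<integral>z. 1 / D l z * h z \<partial>\<mu>)" if l: "l \<in> {1..L}" for l
    using density_in_nonneg_measures_on[OF K M(2) inv(1)[OF l]] inv(2)[OF l] by blast+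
  have "(\<integral>z. v z \<partial>\<mu>p) = (\<integral>x. v (0, x) \<partial>\<mu>0) + (\<integral>z. Lie_deriv f0 v z \<partial>\<mu>)
           + (\<Sum>l\<in>{1..L}. \<integral>z. N l z \<bullet> grad_x v z \<partial>(?\<nu> l))" if v: "C1_nbhd ?K v" for v
  proof -
    note cont = continuous_on_directional[OF v]
    have int: "integrable \<mu> (\<lambda>z. 1 / D l z * (N l z \<bullet> grad_x v z))" if l: "l \<in> {1..L}" for l
      by (intro continuous_integrable_on[OF K M(2)] continuous_on_mult inv(1) l cont(2) N)
    have "(\<integral>z. Lie_deriv (rational_field L f0 N D) v z \<partial>\<mu>) =
        (\<integral>z. Lie_deriv f0 v z + (\<Sum>l\<in>{1..L}. 1 / D l z * (N l z \<bullet> grad_x v z)) \<partial>\<mu>)"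
      by (simp add: Lie_deriv_rational_field)
    also have "\<dots> = (\<integral>z. Lie_deriv f0 v z \<partial>\<mu>) + (\<Sum>l\<in>{1..L}. \<integral>z. 1 / D l z * (N l z \<bullet> grad_x v z) \<partial>\<mu>)"
    proof -
      have "integrable \<mu> (\<lambda>z. \<Sum>l\<in>{1..L}. 1 / D l z * (N l z \<bullet> grad_x v z))"
        by (intro Bochner_Integration.integrable_sum int)
      then show ?thesis
        using Bochner_Integration.integral_add[OF continuous_integrable_on[OF K M(2) cont(1)[OF f0]]]
          Bochner_Integration.integral_sum[of "{1..L}" \<mu> "\<lambda>l z. 1 / D l z * (N l z \<bullet> grad_x v z)", OF int] by simp
    qed
    also have "(\<Sum>l\<in>{1..L}. \<integral>z. 1 / D l z * (N l z \<bullet> grad_x v z) \<partial>\<mu>) =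
        (\<Sum>l\<in>{1..L}. \<integral>z. N l z \<bullet> grad_x v z \<partial>(?\<nu> l))"
      by (intro sum.cong refl dens(2)[symmetric] cont(2) N)
    finally show ?thesis using liouville[OF v] by simp
  qed
  moreover have "(\<integral>z. \<omega> z * D l z \<partial>(?\<nu> l)) = (\<integral>z. \<omega> z \<partial>\<mu>)"
    if l: "l \<in> {1..L}" and \<omega>: "continuous_on ?K \<omega>" for l \<omega>
  proof -
    have "(\<integral>z. \<omega> z * D l z \<partial>(?\<nu> l)) = (\<integral>z. 1 / D l z * (\<omega> z * D l z) \<partial>\<mu>)"
      by (rule dens(2)[OF l continuous_on_mult[OF \<omega> D[OF l]]])
    also have "\<dots> = (\<integral>z. \<omega> z \<partial>\<mu>)"
      using D_pos[OF l] sp by (intro Bochner_Integration.integral_cong) force+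
    finally show ?thesis .
  qed
  ultimately show ?thesis
    unfolding measure_feasible_def using M dens(1) by blast
qed

theorem theorem15:
  fixes L :: nat and T :: real
    and X X0 :: "(real^'n) set"
    and f0 :: "real \<times> (real^'n) \<Rightarrow> real^'n"
    and N :: "nat \<Rightarrow> real \<times> (real^'n) \<Rightarrow> real^'n"
    and D :: "nat \<Rightarrow> real \<times> (real^'n) \<Rightarrow> real"
    and p :: "real^'n \<Rightarrow> real"
  assumes "T > 0" and "X0 \<subseteq> X" and "X0 \<noteq> {}"
    and "polynomial_function f0"
    and "\<And>l. l \<in> {1..L} \<Longrightarrow> polynomial_function (N l)"
    and "\<And>l. l \<in> {1..L} \<Longrightarrow> polynomial_function (D l)"
    and A1: "non_return L f0 N D X0 X"
    and A2: "compact ({0..T} \<times> X0 \<times> X)"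
    and A3: "continuous_on X p"
    and A4: "unique_trajectories L f0 N D T X0"
    and A5: "\<And>l z. l \<in> {1..L} \<Longrightarrow> z \<in> {0..T} \<times> X \<Longrightarrow> D l z > 0"
  shows "measure_value L f0 N D T X0 X p = function_value L f0 N D T X0 X p"
proof (rule antisym)
  let ?K = "{0..T} \<times> X"
  let ?f = "rational_field L f0 N D"
  obtain x0 where x0: "x0 \<in> X0" using assms(3) by blast
  have img: "(\<lambda>w. fst (snd w)) ` ({0..T} \<times> X0 \<times> X) = X0" "(\<lambda>w. snd (snd w)) ` ({0..T} \<times> X0 \<times> X) = X"
    using assms(1-3) by force+
  have X0: "compact X0" and X: "compact X"
    by (subst img[symmetric], rule compact_continuous_image[OF _ A2], intro continuous_intros)+
  have f0: "continuous_on ?K f0"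
    using assms(4) by (rule continuous_on_polymonial_function)
  have N: "continuous_on ?K (N l)" and D: "continuous_on ?K (D l)" if "l \<in> {1..L}" for l
    using assms(5,6)[OF that] by (auto intro: continuous_on_polymonial_function)
  have D_pos: "D l z > 0" if "l \<in> {1..L}" "z \<in> ?K" for l z
    using A5[OF that] .
  have f: "continuous_on ?K ?f"
    unfolding rational_field_def using D_pos
    by (intro continuous_intros f0 N D) force+
  note T = less_imp_le[OF assms(1)]
  show "measure_value L f0 N D T X0 X p \<le> function_value L f0 N D T X0 X p"
    unfolding measure_value_def function_value_def
    using weak_duality[OF X X0 assms(2) T f0 N D A3]
    by (intro Sup_least Inf_greatest) auto
  define G where "G = {\<gamma>. \<exists>v. C1_nbhd ?K v \<and> (\<forall>x\<in>X0. v (0, x) \<le> \<gamma>) \<and>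
    (\<forall>z\<in>?K. p (snd z) \<le> v z) \<and> (\<forall>z\<in>?K. Lie_deriv ?f v z \<le> 0)}"
  have value_le: "function_value L f0 N D T X0 X p \<le> ereal \<gamma>" if \<gamma>: "\<gamma> \<in> G" for \<gamma>
  proof -
    obtain v where v: "C1_nbhd ?K v" "\<forall>x\<in>X0. v (0, x) \<le> \<gamma>" "\<forall>z\<in>?K. p (snd z) \<le> v z"
      "\<forall>z\<in>?K. Lie_deriv ?f v z \<le> 0"
      using \<gamma> unfolding G_def by blast
    define q where "q l z = (N l z \<bullet> grad_x v z) / D l z" for l z
    have "continuous_on ?K (q l)" if l: "l \<in> {1..L}" for l
      unfolding q_def using D_pos[OF l]
      by (intro continuous_on_divide continuous_on_directional(2)[OF v(1)] N D l) force
    moreover have "D l z * q l z - N l z \<bullet> grad_x v z \<ge> 0" if "l \<in> {1..L}" "z \<in> ?K" for l z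
      using D_pos[OF that] by (simp add: q_def)
    moreover have "- Lie_deriv f0 v z - (\<Sum>l\<in>{1..L}. q l z) \<ge> 0" if "z \<in> ?K" for z
      using bspec[OF v(4) that] by (simp add: Lie_deriv_rational_field q_def)
    ultimately have "function_feasible L f0 N D T X0 X p \<gamma> v q"
      unfolding function_feasible_def using v(1-3) by simp
    then show ?thesis
      unfolding function_value_def by (intro Inf_lower) blast
  qed
  define d where "d = Inf G"
  have "G \<noteq> {}"
  proof -
    obtain B where B: "\<forall>x\<in>X. \<bar>p x\<bar> \<le> B"
      using compact_imp_bounded[OF compact_continuous_image[OF A3 X]] by (auto simp: bounded_iff)
    have "B \<in> G"
      unfolding G_def using C1_nbhd_affine_time[of ?K B 0] Lie_deriv_affine_time[of ?f B 0] B
      by (auto intro!: exI[of _ "\<lambda>_. B"] simp: abs_le_iff)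
    then show ?thesis by blast
  qed
  moreover have "bdd_below G"
  proof (rule bdd_belowI)
    show "p x0 \<le> \<gamma>" if "\<gamma> \<in> G" for \<gamma>
      using that x0 assms(2) T unfolding G_def by force
  qed
  ultimately have d: "d \<le> \<gamma>" if "\<gamma> \<in> G" for \<gamma>
    unfolding d_def using that by (intro cInf_lower)
  obtain \<mu>0 \<mu> \<mu>p where M: "\<mu>0 \<in> nonneg_measures_on X0" "\<mu> \<in> nonneg_measures_on ?K"
    "\<mu>p \<in> nonneg_measures_on ?K"
    "\<And>v. C1_nbhd ?K v \<Longrightarrow> (\<integral>z. v z \<partial>\<mu>p) = (\<integral>x. v (0, x) \<partial>\<mu>0) + (\<integral>z. Lie_deriv ?f v z \<partial>\<mu>)"
    "(\<integral>x. 1 \<partial>\<mu>0) = (1::real)" "d \<le> (\<integral>z. p (snd z) \<partial>\<mu>p)"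
  proof (rule liouville_measures_attain[OF T X X0 assms(2,3) A3 f])
    show "d \<le> \<gamma>" if "C1_nbhd ?K v" "\<forall>x\<in>X0. v (0, x) \<le> \<gamma>" "\<forall>z\<in>?K. p (snd z) \<le> v z"
      "\<forall>z\<in>?K. Lie_deriv ?f v z \<le> 0" for \<gamma> v
      using that by (intro d) (auto simp: G_def)
  qed (rule that)
  have "ereal (\<integral>(t, x). p x \<partial>\<mu>p) \<le> measure_value L f0 N D T X0 X p"
    unfolding measure_value_def
    using measure_feasible_of_liouville[OF X f0 N D D_pos M(1-3,5,4)] by (intro Sup_upper) blast
  then have "ereal d \<le> measure_value L f0 N D T X0 X p"
    using M(6) by (simp add: case_prod_unfold) (meson ereal_less_eq(3) order_trans)
  moreover have "function_value L f0 N D T X0 X p \<le> ereal d"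
  proof (rule ereal_le_epsilon2)
    fix e :: real assume "e > 0"
    then obtain \<gamma> where "\<gamma> \<in> G" "\<gamma> < d + e"
      using cInf_lessD[OF \<open>G \<noteq> {}\<close>, of "d + e"] unfolding d_def by auto
    then have "function_value L f0 N D T X0 X p \<le> ereal \<gamma>" "ereal \<gamma> \<le> ereal d + ereal e"
      using value_le by auto
    then show "function_value L f0 N D T X0 X p \<le> ereal d + ereal e" by (rule order_trans)
  qed
  ultimately show "function_value L f0 N D T X0 X p \<le> measure_value L f0 N D T X0 X p"
    by (rule order_trans[rotated])
qed

end
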